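(* Let $V(z)=z^m+\dots\in\mathbb{Z}[z]$ be monic of degree $m\ge1$, let $L=\{z\in\mathbb{C}:|V(z)|=1\}$, and let $\mu$ be the measure on $L$ given by $d\mu(z)=\frac{|V'(z)|}{2\pi m}|dz|$, with $M_L(P)=\exp\left(\int\log|P|\,d\mu\right)$. Define $$B_L=\inf\{M_L(P):P\in\mathbb{Z}[z],\ M_L(P)>1\},\qquad B_{\mathbb{T}}=\inf\{M(P):P\in\mathbb{Z}[z],\ M(P)>1\},$$ where $M(P)=\exp\left(\frac1{2\pi}\int_0^{2\pi}\log|P(e^{i\theta})|\,d\theta\right)$ is the classical Mahler measure. Then $$(B_{\mathbb{T}})^{1/m}\le B_L\le B_{\mathbb{T}}.$$
   Context: The measure $\mu$ is the equilibrium measure of the lemniscate $L$; $M_L$ is the generalized Mahler measure. For $P=c_n\prod_{k=1}^n(z-z_k)$, $c_n\ne0$, one has $M(P)=|c_n|\prod_{k=1}^n\max(1,|z_k|)$; $B_{\mathbb{T}}$ is the quantity $B_L$ for $V(z)=z$. *)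

theory Defs
  imports "HOL-Analysis.Analysis" "HOL-Computational_Algebra.Polynomial"
begin

text \<open>
  Arc length \<open>|dz|\<close> is the one-dimensional Hausdorff measure, normalised by plain diameters, so
  that a rectifiable simple arc has measure equal to its length. The set \<open>|V(z)| = 1\<close> may consist
  of several components and may have self-crossings (at zeros of \<open>V'\<close>).
  The covering sets are required to be bounded because \<^const>\<open>diameter\<close> is
  meaningless on unbounded sets.
\<close>

definition hausdorff1_pre :: "real \<Rightarrow> 'a::metric_space set \<Rightarrow> ennreal" where
  "hausdorff1_pre \<delta> A =
     (INF U \<in> {U :: nat \<Rightarrow> 'a set. A \<subseteq> (\<Union>i. U i) \<and> (\<forall>i. bounded (U i) \<and> diameter (U i) \<le> \<delta>)}.
        \<Sum>i. ennreal (diameter (U i)))"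

definition hausdorff1_outer :: "'a::metric_space set \<Rightarrow> ennreal" where
  "hausdorff1_outer A = (SUP \<delta> \<in> {0<..}. hausdorff1_pre \<delta> A)"

definition hausdorff1 :: "'a::metric_space measure" where
  "hausdorff1 = measure_of UNIV (sets borel) hausdorff1_outer"

abbreviation cpoly :: "int poly \<Rightarrow> complex \<Rightarrow> complex" where
  "cpoly P \<equiv> poly (map_poly of_int P)"

definition lemniscate :: "int poly \<Rightarrow> complex set" where
  "lemniscate V = {z. cmod (cpoly V z) = 1}"

definition lemniscate_measure :: "int poly \<Rightarrow> complex measure" where
  "lemniscate_measure V =
     density (restrict_space hausdorff1 (lemniscate V))
       (\<lambda>z. ennreal (cmod (cpoly (pderiv V) z) / (2 * pi * real (degree V))))"

text \<open>
  The zero polynomial is treated separately since \<open>ln 0 = 0\<close> here, whereas \<open>log 0 = -\<infinity>\<close> is meant.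
  For \<open>P \<noteq> 0\<close> the value of the integrand at the finitely many zeros of \<open>P\<close> is immaterial.
\<close>

definition mahler_measure_lemniscate :: "int poly \<Rightarrow> int poly \<Rightarrow> real" where
  "mahler_measure_lemniscate V P =
     (if P = 0 then 0 else exp (\<integral>z. ln (cmod (cpoly P z)) \<partial>lemniscate_measure V))"

definition mahler_measure :: "int poly \<Rightarrow> real" where
  "mahler_measure P =
     (if P = 0 then 0
      else exp (1 / (2 * pi) * (LINT \<theta>:{0..2 * pi}|lborel. ln (cmod (cpoly P (exp (\<i> * of_real \<theta>)))))))"

definition B_lemniscate :: "int poly \<Rightarrow> real" where
  "B_lemniscate V =
     Inf {mahler_measure_lemniscate V P | P. mahler_measure_lemniscate V P > 1}"

definition B_circle :: real where
  "B_circle = Inf {mahler_measure P | P. mahler_measure P > 1}"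

end

theory Submission
  imports Defs "Jordan_Normal_Form.Determinant" "HOL-Real_Asymp.Real_Asymp"
    "HOL-Computational_Algebra.Fundamental_Theorem_Algebra"
begin

text \<open>
  The map \<open>V\<close> sends the measure \<open>\<mu>\<close> of the lemniscate to the uniform measure of the unit circle: off the
  finitely many critical points, \<open>\<integral> f d\<mu>\<close> is the mean over the circle of the average of \<open>f\<close> over the
  \<open>m\<close> points of the fibre \<open>V(z) = w\<close> (the area formula for one-dimensional Hausdorff measure).
  Apply this to \<open>f = log |P|\<close>. Since \<open>V\<close> is monic, \<open>Q(w) = \<Prod> P(z)\<close>, the product over the fibre,
  is a polynomial in \<open>w\<close> with integer coefficients, so \<open>M\<^sub>L(P)\<^sup>m = M(Q)\<close>, which gives the lower bound. For
  \<open>P = Q \<circ> V\<close> the integrand is constant on fibres, so \<open>M\<^sub>L(Q \<circ> V) = M(Q)\<close>, which gives the upper bound.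
\<close>

section \<open>Hausdorff measure of dimension one\<close>

text \<open>No arc of the lemniscate is parametrised, since branches may cross at zeros of
  \<open>V'\<close> and length is a Hausdorff measure. Instead, off finitely many points, the curve
  is cut into countably many Borel pieces on which an argument of \<open>V\<close> is bi-Lipschitz
  with constants \<open>a\<close> and \<open>b <= q * a\<close>. On each piece Hausdorff measure is
  compared with Lebesgue measure on the line; the relative error \<open>q\<close> survives summation
  over the pieces, and then \<open>q\<close> tends to 1. This requires \<open>hausdorff1\<close> to
  be a genuine Borel measure and to equal \<open>lborel\<close> on the line. A second obstacle is
  the sign of \<open>log |P|\<close>: transfer to the circle is available for nonnegative functions,
  so it is applied to the gap between an upper bound and \<open>log |P|\<close>, and finiteness
  comes from the integrability of \<open>log |Q|\<close> on the circle. Since logarithms of 0 take a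
  default value and fibres with fewer than \<open>m\<close> points spoil the norm identity,
  identities over fibres are asserted off a finite, hence null, set of values.\<close>

lemma hausdorff1_pre_le:
  assumes "A \<subseteq> (\<Union>i. U i)" "\<And>i. bounded (U i)" "\<And>i. diameter (U i) \<le> \<delta>"
  shows "hausdorff1_pre \<delta> A \<le> (\<Sum>i. ennreal (diameter (U i)))"
  unfolding hausdorff1_pre_def using assms by (intro INF_lower) auto

lemma hausdorff1_pre_greatest:
  assumes "\<And>U. A \<subseteq> (\<Union>i. U i) \<Longrightarrow> (\<And>i. bounded (U i)) \<Longrightarrow> (\<And>i. diameter (U i) \<le> \<delta>)
             \<Longrightarrow> x \<le> (\<Sum>i. ennreal (diameter (U i)))"
  shows "x \<le> hausdorff1_pre \<delta> A"
  unfolding hausdorff1_pre_def using assms by (intro INF_greatest) auto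

lemma hausdorff1_pre_antimono:
  "\<delta> \<le> \<delta>' \<Longrightarrow> hausdorff1_pre \<delta>' A \<le> hausdorff1_pre \<delta> A"
  by (rule hausdorff1_pre_greatest, rule hausdorff1_pre_le) (auto intro: order_trans)

lemma hausdorff1_pre_mono:
  "A \<subseteq> B \<Longrightarrow> hausdorff1_pre \<delta> A \<le> hausdorff1_pre \<delta> B"
  by (rule hausdorff1_pre_greatest, rule hausdorff1_pre_le) auto

lemma hausdorff1_pre_le_outer: "\<delta> > 0 \<Longrightarrow> hausdorff1_pre \<delta> A \<le> hausdorff1_outer A"
  unfolding hausdorff1_outer_def by (intro SUP_upper) auto

lemma hausdorff1_outer_least:
  "(\<And>\<delta>. \<delta> > 0 \<Longrightarrow> hausdorff1_pre \<delta> A \<le> x) \<Longrightarrow> hausdorff1_outer A \<le> x"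
  unfolding hausdorff1_outer_def by (intro SUP_least) auto

lemma hausdorff1_outer_mono: "A \<subseteq> B \<Longrightarrow> hausdorff1_outer A \<le> hausdorff1_outer B"
  by (intro hausdorff1_outer_least order_trans[OF hausdorff1_pre_mono hausdorff1_pre_le_outer])

lemma hausdorff1_outer_empty [simp]: "hausdorff1_outer {} = 0"
proof -
  have "hausdorff1_outer ({}::'a set) \<le> 0"
    by (rule hausdorff1_outer_least, rule order_trans[OF hausdorff1_pre_le[where U="\<lambda>_. {}"]]) auto
  then show ?thesis by simp
qed

lemma hausdorff1_outer_singleton [simp]: "hausdorff1_outer {x} = 0"
proof -
  have "hausdorff1_outer {x} \<le> 0"
    by (rule hausdorff1_outer_least, rule order_trans[OF hausdorff1_pre_le[where U="\<lambda>_. {x}"]]) auto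
  then show ?thesis by simp
qed

lemma hausdorff1_pre_countably_subadditive:
  fixes A :: "nat \<Rightarrow> 'a::metric_space set"
  shows "hausdorff1_pre \<delta> (\<Union>n. A n) \<le> (\<Sum>n. hausdorff1_pre \<delta> (A n))"
proof (rule ennreal_le_epsilon)
  fix e :: real
  assume fin: "(\<Sum>n. hausdorff1_pre \<delta> (A n)) < top_class.top" and e: "0 < e"
  have fin': "hausdorff1_pre \<delta> (A n) \<noteq> \<infinity>" for n
    using ennreal_suminf_lessD[OF fin, of n] by simp
  \<comment> \<open>The cover of \<open>A n\<close> may exceed the infimum by
    \<open>e / 2^(n+1)\<close>; these excesses add up to \<open>e\<close>.\<close>
  have "\<exists>U. A n \<subseteq> (\<Union>i. U i) \<and> (\<forall>i. bounded (U i) \<and> diameter (U i) \<le> \<delta>) \<and>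
      (\<Sum>i. ennreal (diameter (U i))) < hausdorff1_pre \<delta> (A n) + ennreal (e * (1/2)^Suc n)" for n
    using INF_approx_ennreal[OF _ hausdorff1_pre_def fin', of "e * (1/2)^Suc n" n] e by auto
  then obtain U where U: "\<And>n. A n \<subseteq> (\<Union>i. U n i)" "\<And>n i. bounded (U n i)"
      "\<And>n i. diameter (U n i) \<le> \<delta>"
      "\<And>n. (\<Sum>i. ennreal (diameter (U n i))) < hausdorff1_pre \<delta> (A n) + ennreal (e * (1/2)^Suc n)"
    by metis
  have "hausdorff1_pre \<delta> (\<Union>n. A n)
      \<le> (\<Sum>i. ennreal (diameter ((\<lambda>(m, n). U m n) (prod_decode i))))"
  proof (rule hausdorff1_pre_le)
    show "(\<Union>n. A n) \<subseteq> (\<Union>i. (\<lambda>(m, n). U m n) (prod_decode i))"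
    proof safe
      fix x n assume "x \<in> A n"
      then obtain i where "x \<in> U n i" using U(1) by blast
      then show "x \<in> (\<Union>i. (\<lambda>(m, n). U m n) (prod_decode i))"
        by (intro UN_I[of "prod_encode (n, i)"]) auto
    qed
  qed (auto simp: U split: prod.splits)
  also have "\<dots> = (\<Sum>m. \<Sum>n. ennreal (diameter (U m n)))"
    by (rule suminf_ennreal_2dimen[where f="\<lambda>p. ennreal (diameter ((\<lambda>(m, n). U m n) p))"]) simp
  also have "\<dots> \<le> (\<Sum>n. hausdorff1_pre \<delta> (A n) + ennreal (e * (1/2)^Suc n))"
    by (intro suminf_le less_imp_le U(4)) auto
  also have "\<dots> = (\<Sum>n. hausdorff1_pre \<delta> (A n)) + (\<Sum>n. ennreal (e * (1/2)^Suc n))"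
    by (rule suminf_add[symmetric]) auto
  also have "(\<Sum>n. ennreal (e * (1/2)^Suc n)) = ennreal e"
    using e sums_mult[OF power_half_series, of e] by (intro suminf_ennreal_eq) auto
  finally show "hausdorff1_pre \<delta> (\<Union>n. A n) \<le> (\<Sum>n. hausdorff1_pre \<delta> (A n)) + ennreal e" .
qed

lemma hausdorff1_outer_countably_subadditive:
  "hausdorff1_outer (\<Union>n. A n) \<le> (\<Sum>n. hausdorff1_outer (A n))"
  by (intro hausdorff1_outer_least order_trans[OF hausdorff1_pre_countably_subadditive]
      suminf_le hausdorff1_pre_le_outer) auto

lemma hausdorff1_outer_subadditive:
  "hausdorff1_outer (A \<union> B) \<le> hausdorff1_outer A + hausdorff1_outer B"
proof -
  define C where "C n = (if n = 0 then A else if n = Suc 0 then B else {})" for n :: nat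
  have "(\<Union>n. C n) = A \<union> B"
    by (auto simp: C_def split: if_splits)
  then have "hausdorff1_outer (A \<union> B) \<le> (\<Sum>n. hausdorff1_outer (C n))"
    using hausdorff1_outer_countably_subadditive[of C] by simp
  also have "\<dots> = (\<Sum>n\<in>{0, Suc 0}. hausdorff1_outer (C n))"
    by (rule suminf_finite) (auto simp: C_def)
  finally show ?thesis by (simp add: C_def)
qed

lemma outer_measure_space_hausdorff1_outer: "outer_measure_space (Pow UNIV) hausdorff1_outer"
  unfolding outer_measure_space_def positive_def increasing_def countably_subadditive_def
  by (simp add: hausdorff1_outer_mono hausdorff1_outer_countably_subadditive)

section \<open>Additivity on separated sets and measurability of Borel sets\<close>

text \<open>A covering set of diameter below the gap \<open>d\<close> cannot meet both
  \<open>A\<close> and \<open>B\<close>, so a cover of the union splits into two covers that share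
  no index with positive contribution.\<close>

lemma hausdorff1_pre_separated:
  assumes "\<delta> < d" "\<And>x y. x \<in> A \<Longrightarrow> y \<in> B \<Longrightarrow> d \<le> dist x y"
  shows "hausdorff1_pre \<delta> A + hausdorff1_pre \<delta> B \<le> hausdorff1_pre \<delta> (A \<union> B)"
proof (rule hausdorff1_pre_greatest)
  fix U :: "nat \<Rightarrow> 'a set"
  assume U: "A \<union> B \<subseteq> (\<Union>i. U i)" "\<And>i. bounded (U i)" "\<And>i. diameter (U i) \<le> \<delta>"
  have sep: "U i \<inter> A = {} \<or> U i \<inter> B = {}" for i
  proof (rule ccontr)
    assume "\<not> ?thesis"
    then obtain x y where xy: "x \<in> U i" "x \<in> A" "y \<in> U i" "y \<in> B" by blast
    then show False
      using assms(1) assms(2)[of x y] diameter_bounded_bound[OF U(2) xy(1,3)] U(3)[of i] by linarith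
  qed
  have sub: "hausdorff1_pre \<delta> C \<le> (\<Sum>i. ennreal (if U i \<inter> C = {} then 0 else diameter (U i)))"
    if "C \<subseteq> A \<union> B" for C
  proof -
    have "hausdorff1_pre \<delta> C \<le> (\<Sum>i. ennreal (diameter (if U i \<inter> C = {} then {} else U i)))"
    proof (rule hausdorff1_pre_le)
      show "C \<subseteq> (\<Union>i. if U i \<inter> C = {} then {} else U i)"
        using U(1) that by fastforce
      show "diameter (if U i \<inter> C = {} then {} else U i) \<le> \<delta>" for i
        using U(3)[of i] diameter_ge_0[OF U(2), of i] by auto
    qed (use U in auto)
    also have "\<dots> = (\<Sum>i. ennreal (if U i \<inter> C = {} then 0 else diameter (U i)))"
      by (intro arg_cong[where f=suminf] ext) auto
    finally show ?thesis .
  qed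
  have "hausdorff1_pre \<delta> A + hausdorff1_pre \<delta> B
      \<le> (\<Sum>i. ennreal (if U i \<inter> A = {} then 0 else diameter (U i)))
       + (\<Sum>i. ennreal (if U i \<inter> B = {} then 0 else diameter (U i)))"
    by (intro add_mono sub) auto
  also have "\<dots> = (\<Sum>i. ennreal (if U i \<inter> A = {} then 0 else diameter (U i))
       + ennreal (if U i \<inter> B = {} then 0 else diameter (U i)))"
    by (rule suminf_add) auto
  also have "\<dots> \<le> (\<Sum>i. ennreal (diameter (U i)))"
    using sep by (intro suminf_le) (auto simp: if_splits)
  finally show "hausdorff1_pre \<delta> A + hausdorff1_pre \<delta> B \<le> (\<Sum>i. ennreal (diameter (U i)))" .
qed

text \<open>A sequence of mesh sizes makes the premeasures an increasing sequence, to which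
  additivity of monotone suprema applies.\<close>

lemma hausdorff1_outer_eq_SUP:
  assumes "d > 0"
  shows "hausdorff1_outer A = (SUP n. hausdorff1_pre (d / real (Suc n)) A)"
proof (rule antisym)
  show "hausdorff1_outer A \<le> (SUP n. hausdorff1_pre (d / real (Suc n)) A)"
  proof (rule hausdorff1_outer_least)
    fix \<delta> :: real assume "\<delta> > 0"
    then obtain n where "d / \<delta> < real n" using reals_Archimedean2 by blast
    then have "d / real (Suc n) \<le> \<delta>"
      using \<open>\<delta> > 0\<close> by (simp add: field_simps)
    then show "hausdorff1_pre \<delta> A \<le> (SUP n. hausdorff1_pre (d / real (Suc n)) A)"
      by (intro SUP_upper2[of n] hausdorff1_pre_antimono) auto
  qed
qed (use assms in \<open>auto intro!: SUP_least hausdorff1_pre_le_outer\<close>)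

lemma hausdorff1_outer_separated:
  assumes "0 < d" "\<And>x y. x \<in> A \<Longrightarrow> y \<in> B \<Longrightarrow> d \<le> dist x y"
  shows "hausdorff1_outer (A \<union> B) = hausdorff1_outer A + hausdorff1_outer B"
proof (rule antisym[OF hausdorff1_outer_subadditive])
  \<comment> \<open>Starting at \<open>d/2\<close> keeps every mesh size strictly below the gap
    \<open>d\<close>.\<close>
  let ?d = "\<lambda>n. (d/2) / real (Suc n)"
  have inc: "incseq (\<lambda>n. hausdorff1_pre (?d n) C)" for C :: "'a set"
    using assms(1) by (intro monoI hausdorff1_pre_antimono divide_left_mono) auto
  have lt: "?d n < d" for n
    using assms(1) by (simp add: field_simps add_strict_increasing)
  have "hausdorff1_outer A + hausdorff1_outer B
      = (SUP n. hausdorff1_pre (?d n) A + hausdorff1_pre (?d n) B)"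
    unfolding ennreal_SUP_add[OF inc inc] using assms(1) by (subst (1 2) hausdorff1_outer_eq_SUP[of "d/2"]) auto
  also have "\<dots> \<le> (SUP n. hausdorff1_pre (?d n) (A \<union> B))"
    by (intro SUP_mono' hausdorff1_pre_separated[OF lt] assms) auto
  also have "\<dots> = hausdorff1_outer (A \<union> B)"
    using assms(1) by (intro hausdorff1_outer_eq_SUP[symmetric]) auto
  finally show "hausdorff1_outer A + hausdorff1_outer B \<le> hausdorff1_outer (A \<union> B)" .
qed

text \<open>Caratheodory's criterion for metric outer measures. The points of \<open>X\<close> at
  distance at least \<open>1/(n+1)\<close> from \<open>C\<close> form a set \<open>B n\<close>
  separated from \<open>C\<close>, so additivity holds with \<open>B n\<close> in place of
  \<open>X - C\<close>. What is missing is a union of shells \<open>D k\<close>, whose measures have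
  a finite sum, so the missing part becomes negligible as \<open>n\<close> grows.\<close>

lemma closed_in_lambda_system_hausdorff1:
  fixes C :: "'a::metric_space set"
  assumes "closed C"
  shows "C \<in> lambda_system UNIV (Pow UNIV) hausdorff1_outer"
proof -
  let ?H = "hausdorff1_outer :: 'a set \<Rightarrow> ennreal"
  have main: "?H (C \<inter> X) + ?H (X - C) \<le> ?H X" for X
  \<comment> \<open>The distance to the empty set is 0 by convention, so \<open>infdist\<close>
    cannot detect its complement; that case and infinite measure are immediate.\<close>
  proof (cases "?H X = \<infinity> \<or> C = {}")
    case False
    then have fin: "?H X < \<infinity>" and "C \<noteq> {}" by (auto simp: less_top)
    define B where "B n = {x\<in>X. 1 / real (Suc n) \<le> infdist x C}" for n :: nat
    define D where "D n = B (Suc n) - B n" for n :: nat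
    have sep: "1 / real (Suc n) - 1 / real (Suc (Suc n)) \<le> dist x y"
      if "x \<in> B n" "y \<in> X" "y \<notin> B (Suc n)" for x y n
      using that infdist_triangle[of x C y] unfolding B_def by auto
    have gap: "0 < 1 / real (Suc n) - 1 / real (Suc (Suc n))" for n
      by (simp add: frac_less2)
    have Bmono: "B m \<subseteq> B n" if "m \<le> n" for m n
    proof -
      have "1 / real (Suc n) \<le> 1 / real (Suc m)" using that by (simp add: field_simps)
      then show ?thesis unfolding B_def by auto
    qed
    have HB: "?H (C \<inter> X) + ?H (B n) \<le> ?H X" for n
    proof -
      have "?H ((C \<inter> X) \<union> B n) = ?H (C \<inter> X) + ?H (B n)"
      proof (rule hausdorff1_outer_separated[of "1 / real (Suc n)"])
        fix x y assume "x \<in> C \<inter> X" "y \<in> B n"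
        then show "1 / real (Suc n) \<le> dist x y"
          using infdist_le[of x C y] unfolding B_def by (auto simp: dist_commute)
      qed auto
      moreover have "(C \<inter> X) \<union> B n \<subseteq> X" unfolding B_def by auto
      ultimately show ?thesis by (metis hausdorff1_outer_mono)
    qed
    have DB: "D k \<subseteq> B n" if "k < n" for k n
      using Bmono[of "Suc k" n] that unfolding D_def by auto
    \<comment> \<open>Neighbouring shells can touch, but shells two indices apart are separated by
      \<open>gap\<close>. Hence the measures of shells of one parity add up to the measure of their
      union, which lies in \<open>X\<close>.\<close>
    have parity: "(\<Sum>k<N. ?H (D (2*k + p))) \<le> ?H X" for N p
    proof -
      have "(\<Sum>k<N. ?H (D (2*k + p))) = ?H (\<Union>k<N. D (2*k + p))"
      proof (induction N)
        case (Suc N)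
        have "?H ((\<Union>k<N. D (2*k + p)) \<union> D (2*N + p)) = ?H (\<Union>k<N. D (2*k + p)) + ?H (D (2*N + p))"
        proof (cases N)
          case (Suc M)
          have "(\<Union>k<N. D (2*k + p)) \<subseteq> B (2*M + p + 1)"
            using Suc by (intro UN_least DB) auto
          moreover have "D (2*N + p) \<subseteq> X - B (Suc (2*M + p + 1))"
            unfolding D_def B_def using Suc by auto
          ultimately show ?thesis
            using sep[of _ "2*M + p + 1"]
            by (intro hausdorff1_outer_separated[OF gap[of "2*M + p + 1"]]) blast
        qed auto
        moreover have "(\<Union>k<Suc N. D (2*k + p)) = (\<Union>k<N. D (2*k + p)) \<union> D (2*N + p)"
          by (auto simp: less_Suc_eq)
        ultimately show ?case by (simp add: Suc)
      qed auto
      also have "\<dots> \<le> ?H X"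
        by (rule hausdorff1_outer_mono) (auto simp: D_def B_def)
      finally show ?thesis .
    qed
    have "(\<Sum>k<n. ?H (D k)) \<le> 2 * ?H X" for n
    proof -
      have "(\<Sum>k<n. ?H (D k)) \<le> (\<Sum>k<2*n. ?H (D k))"
        by (rule sum_mono2) auto
      also have "\<dots> = (\<Sum>k<n. ?H (D (2*k + 0))) + (\<Sum>k<n. ?H (D (2*k + 1)))"
        by (induction n) (auto simp: ac_simps)
      also have "\<dots> \<le> ?H X + ?H X" by (intro add_mono parity)
      finally show ?thesis by (simp add: mult_2)
    qed
    then have "(\<Sum>k. ?H (D k)) \<le> 2 * ?H X"
      by (intro suminf_le_const) auto
    also have "\<dots> < \<infinity>" using fin by (simp add: ennreal_mult_less_top)
    finally have sumfin: "(\<Sum>k. ?H (D k)) \<noteq> \<infinity>" by simp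
    have XC: "X - C = B n \<union> (\<Union>k. D (k + n))" for n
    proof (intro equalityI subsetI)
      fix x assume x: "x \<in> X - C"
      \<comment> \<open>This is where closedness of \<open>C\<close> enters: a point outside has
        positive distance and so reaches some \<open>B m\<close>.\<close>
      then have "0 < infdist x C"
        using assms \<open>C \<noteq> {}\<close> by (simp add: infdist_pos_not_in_closed)
      then obtain m where "1 / real (Suc m) < infdist x C"
        using nat_approx_posE by metis
      then have "x \<in> B m" using x unfolding B_def by auto
      then have "\<exists>m. x \<in> B m" ..
      define l where "l = (LEAST m. x \<in> B m)"
      have l: "x \<in> B l" "\<And>k. k < l \<Longrightarrow> x \<notin> B k"
        using \<open>x \<in> B m\<close> unfolding l_def by (auto intro: LeastI dest: not_less_Least)
      show "x \<in> B n \<union> (\<Union>k. D (k + n))"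
      proof (cases "l \<le> n")
        case True then show ?thesis using l(1) Bmono by auto
      next
        case False
        then have "x \<in> D ((l - 1 - n) + n)" unfolding D_def using l by auto
        then show ?thesis by blast
      qed
    next
      fix x assume "x \<in> B n \<union> (\<Union>k. D (k + n))"
      then obtain k where "x \<in> B k" unfolding D_def by auto
      then have "x \<in> X" "1 / real (Suc k) \<le> infdist x C" unfolding B_def by auto
      moreover have "0 < 1 / real (Suc k)" by simp
      ultimately have "x \<in> X" "0 < infdist x C" by linarith+
      then show "x \<in> X - C" by auto
    qed
    have "?H (C \<inter> X) + ?H (X - C) \<le> ?H X + ennreal e" if "e > 0" for e
    proof -
      \<comment> \<open>The series of shell measures is finite, so some tail is at most
        \<open>e\<close>; that tail bounds the part of \<open>X - C\<close> outside
        \<open>B n\<close>.\<close>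
      have "\<exists>n. (\<Sum>k. ?H (D k)) < (\<Sum>k<n. ?H (D k)) + ennreal e"
        using SUP_approx_ennreal[OF that _ suminf_eq_SUP sumfin] by auto
      then obtain n where n: "(\<Sum>k. ?H (D k)) < (\<Sum>k<n. ?H (D k)) + ennreal e" by blast
      have split: "(\<Sum>k. ?H (D k)) = (\<Sum>k<n. ?H (D k)) + (\<Sum>k. ?H (D (k + n)))"
        by (subst add.commute) (rule suminf_offset, auto)
      then have "(\<Sum>k<n. ?H (D k)) \<noteq> \<infinity>"
        using sumfin by auto
      then have tail: "(\<Sum>k. ?H (D (k + n))) \<le> ennreal e"
        using less_imp_le[OF n] unfolding split ennreal_add_left_cancel_le by simp
      have "?H (X - C) \<le> ?H (B n) + ?H (\<Union>k. D (k + n))"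
        unfolding XC[of n] by (rule hausdorff1_outer_subadditive)
      also have "\<dots> \<le> ?H (B n) + ennreal e"
        by (intro add_left_mono order_trans[OF hausdorff1_outer_countably_subadditive] tail)
      finally have "?H (C \<inter> X) + ?H (X - C) \<le> ?H (C \<inter> X) + ?H (B n) + ennreal e"
        by (simp add: add.assoc add_left_mono)
      also have "\<dots> \<le> ?H X + ennreal e" by (intro add_right_mono HB)
      finally show ?thesis .
    qed
    then show ?thesis by (rule ennreal_le_epsilon)
  qed auto
  have "?H (C \<inter> X) + ?H ((UNIV - C) \<inter> X) = ?H X" for X
  proof (rule antisym)
    show "?H X \<le> ?H (C \<inter> X) + ?H ((UNIV - C) \<inter> X)"
      using hausdorff1_outer_subadditive[of "C \<inter> X" "(UNIV - C) \<inter> X"]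
      by (simp add: Int_Un_distrib2[symmetric])
    have "(UNIV - C) \<inter> X = X - C" by auto
    then show "?H (C \<inter> X) + ?H ((UNIV - C) \<inter> X) \<le> ?H X" using main by metis
  qed
  then show ?thesis by (simp add: lambda_system_def)
qed

text \<open>\<open>measure_of\<close> returns the zero measure unless its set function is countably
  additive on the generated sigma algebra. Caratheodory's theorem gives additivity on the lambda
  system, which contains the closed sets and therefore all Borel sets.\<close>

lemma measure_space_hausdorff1_outer:
  "measure_space UNIV (sets borel) (hausdorff1_outer :: 'a::metric_space set \<Rightarrow> ennreal)"
proof -
  let ?L = "lambda_system UNIV (Pow UNIV) (hausdorff1_outer :: 'a set \<Rightarrow> ennreal)"
  have L: "measure_space UNIV ?L hausdorff1_outer"
    using sigma_algebra.caratheodory_lemma[OF sigma_algebra_Pow outer_measure_space_hausdorff1_outer] .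
  then have "sigma_algebra UNIV ?L" by (simp add: measure_space_def)
  then have "sigma_sets UNIV (Collect closed) \<subseteq> ?L"
    using closed_in_lambda_system_hausdorff1 by (intro sigma_algebra.sigma_sets_subset) auto
  then have "sets borel \<subseteq> ?L" by (simp add: borel_eq_closed)
  then show ?thesis
    by (rule measure_down[OF L sets.sigma_algebra_axioms[of borel, simplified]])
qed

lemma sets_hausdorff1 [simp, measurable_cong]: "sets hausdorff1 = sets borel"
  unfolding hausdorff1_def by (metis sets.sets_measure_of_eq space_borel)

lemma space_hausdorff1 [simp]: "space hausdorff1 = UNIV"
  unfolding hausdorff1_def by (simp add: space_measure_of_conv)

lemma emeasure_hausdorff1: "A \<in> sets borel \<Longrightarrow> emeasure hausdorff1 A = hausdorff1_outer A"
  using measure_space_hausdorff1_outer[where 'a='a] unfolding hausdorff1_def measure_space_def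
  by (intro emeasure_measure_of_sigma) auto

section \<open>Lipschitz images and Hausdorff measure on the real line\<close>

text \<open>The image of a cover of mesh \<open>\<delta> / K\<close> is a cover of mesh
  \<open>\<delta>\<close>, with diameters at most \<open>K\<close> times as large. The factor is
  first moved to the left as \<open>1 / K\<close>, so that the infimum over covers of
  \<open>A\<close> can be taken.\<close>

lemma hausdorff1_outer_lipschitz_image:
  assumes "0 < K" "\<And>x y. x \<in> A \<Longrightarrow> y \<in> A \<Longrightarrow> dist (f x) (f y) \<le> K * dist x y"
  shows "hausdorff1_outer (f ` A) \<le> ennreal K * hausdorff1_outer A"
proof (rule hausdorff1_outer_least)
  fix \<delta> :: real assume "\<delta> > 0"
  have "ennreal (1 / K) * hausdorff1_pre \<delta> (f ` A) \<le> hausdorff1_pre (\<delta> / K) A"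
  proof (rule hausdorff1_pre_greatest)
    fix U :: "nat \<Rightarrow> 'a set"
    assume U: "A \<subseteq> (\<Union>i. U i)" "\<And>i. bounded (U i)" "\<And>i. diameter (U i) \<le> \<delta> / K"
    have *: "dist (f x) (f y) \<le> K * diameter (U i)" if "x \<in> A \<inter> U i" "y \<in> A \<inter> U i" for i x y
    proof -
      have "dist (f x) (f y) \<le> K * dist x y" using that assms(2) by auto
      also have "\<dots> \<le> K * diameter (U i)"
        using that U(2) assms(1) by (intro mult_left_mono diameter_bounded_bound) auto
      finally show ?thesis .
    qed
    have d: "diameter (f ` (A \<inter> U i)) \<le> K * diameter (U i)" for i
      using * diameter_ge_0[of "U i"] U(2) assms(1)
      unfolding diameter_def[of "f ` (A \<inter> U i)"] by (auto intro!: cSUP_least)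
    have "hausdorff1_pre \<delta> (f ` A) \<le> (\<Sum>i. ennreal (diameter (f ` (A \<inter> U i))))"
    proof (rule hausdorff1_pre_le)
      show "f ` A \<subseteq> (\<Union>i. f ` (A \<inter> U i))" using U(1) by blast
      show "bounded (f ` (A \<inter> U i))" for i
        unfolding bounded_two_points using * by blast
      show "diameter (f ` (A \<inter> U i)) \<le> \<delta>" for i
        using d[of i] U(3)[of i] assms(1) by (auto simp: field_simps intro: order_trans)
    qed
    also have "\<dots> \<le> (\<Sum>i. ennreal K * ennreal (diameter (U i)))"
      using d assms(1) diameter_ge_0[OF U(2)]
      by (intro suminf_le) (auto simp: ennreal_mult[symmetric] intro!: ennreal_leI)
    finally have "ennreal (1 / K) * hausdorff1_pre \<delta> (f ` A)
        \<le> ennreal (1 / K) * (ennreal K * (\<Sum>i. ennreal (diameter (U i))))"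
      by (intro mult_left_mono) auto
    then show "ennreal (1 / K) * hausdorff1_pre \<delta> (f ` A) \<le> (\<Sum>i. ennreal (diameter (U i)))"
      using assms(1) by (simp add: mult.assoc[symmetric] ennreal_mult[symmetric])
  qed
  then have "ennreal K * (ennreal (1 / K) * hausdorff1_pre \<delta> (f ` A))
      \<le> ennreal K * hausdorff1_pre (\<delta> / K) A"
    by (rule mult_left_mono) auto
  then have "hausdorff1_pre \<delta> (f ` A) \<le> ennreal K * hausdorff1_pre (\<delta> / K) A"
    using assms(1) by (simp add: mult.assoc[symmetric] ennreal_mult[symmetric])
  also have "\<dots> \<le> ennreal K * hausdorff1_outer A"
    using \<open>\<delta> > 0\<close> assms(1) by (intro mult_left_mono hausdorff1_pre_le_outer) auto
  finally show "hausdorff1_pre \<delta> (f ` A) \<le> ennreal K * hausdorff1_outer A" .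
qed

text \<open>Cutting into equal short pieces gives the upper bound; countable subadditivity of
  Lebesgue measure gives the lower one. Values on open intervals are what determines
  \<open>lborel\<close>.\<close>

lemma hausdorff1_outer_interval:
  fixes l u :: real
  assumes "l \<le> u"
  shows "hausdorff1_outer {l<..<u} = ennreal (u - l)"
proof (rule antisym)
  show "hausdorff1_outer {l<..<u} \<le> ennreal (u - l)"
  proof (rule hausdorff1_outer_least)
    fix \<delta> :: real assume "\<delta> > 0"
    then obtain n where n: "(u - l) / \<delta> < real n" using reals_Archimedean2 by blast
    moreover have "0 \<le> (u - l) / \<delta>" using assms \<open>\<delta> > 0\<close> by simp
    ultimately have "0 < n" by (metis of_nat_0_less_iff order_le_less_trans)
    define d where "d = (u - l) / real n"
    have d: "0 \<le> d" "d \<le> \<delta>" "real n * d = u - l"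
      unfolding d_def using assms n \<open>0 < n\<close> \<open>\<delta> > 0\<close> by (auto simp: field_simps)
    have "hausdorff1_pre \<delta> {l<..<u}
        \<le> (\<Sum>i. ennreal (diameter (if i < n then {l + real i * d .. l + real (Suc i) * d} else {})))"
    proof (rule hausdorff1_pre_le)
      show "{l<..<u} \<subseteq> (\<Union>i. if i < n then {l + real i * d .. l + real (Suc i) * d} else {})"
      proof
        fix x assume x: "x \<in> {l<..<u}"
        then have "l < u" by auto
        then have "d > 0" unfolding d_def using \<open>0 < n\<close> by simp
        define i where "i = nat \<lfloor>(x - l) / d\<rfloor>"
        have nn: "0 \<le> (x - l) / d" using x \<open>d > 0\<close> by simp
        then have i: "real i \<le> (x - l) / d" "(x - l) / d < real i + 1"
          unfolding i_def by (auto simp: of_nat_nat)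
        have "(x - l) / d < real n"
          using x d(3) \<open>d > 0\<close> by (simp add: field_simps)
        then have "i < n" using i(1) by linarith
        moreover have "x \<in> {l + real i * d .. l + real (Suc i) * d}"
          using i \<open>d > 0\<close> by (simp add: field_simps)
        ultimately show "x \<in> (\<Union>i. if i < n then {l + real i * d .. l + real (Suc i) * d} else {})"
          by (intro UN_I[of i]) auto
      qed
    qed (use d \<open>\<delta> > 0\<close> in \<open>auto simp: algebra_simps\<close>)
    also have "\<dots> = (\<Sum>i<n. ennreal (diameter (if i < n then {l + real i * d .. l + real (Suc i) * d} else {})))"
      by (rule suminf_finite) auto
    also have "\<dots> = (\<Sum>i<n. ennreal d)"
      using d by (intro sum.cong) (auto simp: algebra_simps)
    also have "\<dots> = ennreal (u - l)"
      using d by (simp add: ennreal_mult[symmetric] ennreal_of_nat_eq_real_of_nat)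
    finally show "hausdorff1_pre \<delta> {l<..<u} \<le> ennreal (u - l)" .
  qed
next
  have "ennreal (u - l) \<le> hausdorff1_pre 1 {l<..<u}"
  proof (rule hausdorff1_pre_greatest)
    fix U :: "nat \<Rightarrow> real set"
    assume U: "{l<..<u} \<subseteq> (\<Union>i. U i)" "\<And>i. bounded (U i)" "\<And>i. diameter (U i) \<le> 1"
    \<comment> \<open>A bounded set of reals lies in the interval that starts at its infimum and has
      its diameter as length. The empty set is kept apart because its infimum is
      unspecified.\<close>
    let ?I = "\<lambda>i. if U i = {} then {} else {Inf (U i) .. Inf (U i) + diameter (U i)}"
    have sub: "U i \<subseteq> ?I i" for i
    proof (cases "U i = {}")
      case False
      have b: "bdd_below (U i)" using U(2) by (rule bounded_imp_bdd_below)
      have "x \<le> Inf (U i) + diameter (U i)" if "x \<in> U i" for x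
      proof -
        have "x - diameter (U i) \<le> Inf (U i)"
          using False diameter_bounded_bound[OF U(2) that] 
          by (intro cInf_greatest) (fastforce simp: dist_real_def)+
        then show ?thesis by simp
      qed
      then show ?thesis using False b by (auto intro: cInf_lower)
    qed auto
    have "ennreal (u - l) = emeasure lborel {l<..<u}" using assms by simp
    also have "\<dots> \<le> emeasure lborel (\<Union>i. ?I i)"
      using U(1) sub by (intro emeasure_mono) (blast, auto)
    also have "\<dots> \<le> (\<Sum>i. emeasure lborel (?I i))"
      by (rule emeasure_subadditive_countably) auto
    also have "\<dots> \<le> (\<Sum>i. ennreal (diameter (U i)))"
      using diameter_ge_0[OF U(2)] by (intro suminf_le) auto
    finally show "ennreal (u - l) \<le> (\<Sum>i. ennreal (diameter (U i)))" .
  qed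
  also have "\<dots> \<le> hausdorff1_outer {l<..<u}" by (rule hausdorff1_pre_le_outer) auto
  finally show "ennreal (u - l) \<le> hausdorff1_outer {l<..<u}" .
qed

lemma hausdorff1_real: "(hausdorff1 :: real measure) = lborel"
  by (rule lborel_eqI[symmetric]) (auto simp: emeasure_hausdorff1 hausdorff1_outer_interval)

section \<open>The area formula for level curves\<close>

lemma ennreal_le_of_le_mult:
  fixes x y :: ennreal
  assumes "\<And>q::real. q > 1 \<Longrightarrow> x \<le> ennreal q * y"
  shows "x \<le> y"
proof (rule ennreal_le_epsilon)
  fix e :: real assume "y < top_class.top" "0 < e"
  then obtain b where b: "y = ennreal b" "0 \<le> b" by (cases y) auto
  \<comment> \<open>The denominator \<open>b + 1\<close> admits \<open>b = 0\<close> and keeps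
    \<open>q * b - b\<close> at most \<open>e\<close>.\<close>
  define q where "q = 1 + e / (b + 1)"
  have "q > 1" unfolding q_def using \<open>0 < e\<close> b by simp
  have "q * b = b + e * (b / (b + 1))" unfolding q_def by (simp add: field_simps)
  also have "\<dots> \<le> b + e * 1"
    using b \<open>0 < e\<close> by (intro add_left_mono mult_left_mono) auto
  finally have "q * b \<le> b + e" by simp
  have "x \<le> ennreal q * y" by (rule assms) fact
  also have "\<dots> = ennreal (q * b)" using b \<open>q > 1\<close> by (simp add: ennreal_mult)
  also have "\<dots> \<le> ennreal (b + e)" by (rule ennreal_leI) fact
  also have "\<dots> = y + ennreal e" using b \<open>0 < e\<close> by simp
  finally show "x \<le> y + ennreal e" .
qed

text \<open>Here \<open>\<phi>\<close> is injective on \<open>K\<close>, so \<open>N t\<close> is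
  \<open>f\<close> at the single preimage of \<open>t\<close>. Lebesgue measure on the image of
  \<open>A\<close>, pulled back to \<open>A\<close>, lies between \<open>a\<close> and
  \<open>b\<close> times Hausdorff measure; the weight \<open>w\<close> lies between the same
  constants, so the two integrals differ by a factor of at most \<open>b / a\<close>.\<close>

lemma area_formula_bilipschitz:
  fixes \<phi> :: "'a::metric_space \<Rightarrow> real" and f :: "'a \<Rightarrow> ennreal" and w :: "'a \<Rightarrow> real"
  assumes K: "compact K" and A: "A \<in> sets borel" "A \<subseteq> K"
    and ab: "0 < a" "0 < q" "b \<le> q * a"
    and bilip: "\<And>x y. x \<in> K \<Longrightarrow> y \<in> K \<Longrightarrow> a * dist x y \<le> dist (\<phi> x) (\<phi> y) \<and> dist (\<phi> x) (\<phi> y) \<le> b * dist x y"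
    and w: "\<And>x. x \<in> A \<Longrightarrow> a \<le> w x \<and> w x \<le> b"
    and meas [measurable]: "f \<in> borel_measurable borel" "w \<in> borel_measurable borel"
  defines "N \<equiv> \<lambda>t. \<integral>\<^sup>+z. f z * indicator {z \<in> A. \<phi> z = t} z \<partial>count_space UNIV"
  shows "N \<in> borel_measurable borel"
    and "integral\<^sup>N lborel N \<le> ennreal q * (\<integral>\<^sup>+z. f z * ennreal (w z) * indicator A z \<partial>hausdorff1)"
    and "(\<integral>\<^sup>+z. f z * ennreal (w z) * indicator A z \<partial>hausdorff1) \<le> ennreal q * integral\<^sup>N lborel N"
proof -
  note [measurable] = A(1)
  have inj: "inj_on \<phi> K"
  proof (rule inj_onI)
    fix x y assume "x \<in> K" "y \<in> K" "\<phi> x = \<phi> y"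
    then have "a * dist x y \<le> 0" using bilip[of x y] by simp
    then show "x = y" using ab(1) by (simp add: mult_le_0_iff)
  qed
  have nonempty: "N \<in> borel_measurable borel \<and>
      integral\<^sup>N lborel N \<le> ennreal q * (\<integral>\<^sup>+z. f z * ennreal (w z) * indicator A z \<partial>hausdorff1) \<and>
      (\<integral>\<^sup>+z. f z * ennreal (w z) * indicator A z \<partial>hausdorff1) \<le> ennreal q * integral\<^sup>N lborel N"
    if ne: "A \<noteq> {}"
  proof -
    have b: "0 < b" using ne w ab(1) by force
    have cont: "continuous_on K \<phi>"
    proof (rule lipschitz_on_continuous_on)
      show "b-lipschitz_on K \<phi>" using bilip b by (intro lipschitz_onI) auto
    qed
    \<comment> \<open>Compactness of \<open>K\<close> makes the inverse continuous on the image; the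
      constant value elsewhere makes \<open>g\<close> Borel on the whole line.\<close>
    define g where "g t = (if t \<in> \<phi> ` K then inv_into K \<phi> t else undefined)" for t
    have g: "g (\<phi> x) = x" if "x \<in> K" for x
      unfolding g_def using that inj by simp
    have cmp: "compact (\<phi> ` K)" using cont K by (rule compact_continuous_image)
    have "continuous_on (\<phi> ` K) (inv_into K \<phi>)"
      using cont K inj by (intro continuous_on_inv) auto
    then have [measurable]: "g \<in> borel_measurable borel"
      unfolding g_def using borel_compact[OF cmp]
      by (intro borel_measurable_continuous_on_if) auto
    \<comment> \<open>Images of Borel sets are thereby rewritten as preimages under
      \<open>g\<close>, hence Borel.\<close>
    have im: "\<phi> ` (A \<inter> B) = \<phi> ` K \<inter> g -` (A \<inter> B)" for B
      using A(2) g by force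
    have im_borel [measurable]: "\<phi> ` (A \<inter> B) \<in> sets borel" if [measurable]: "B \<in> sets borel" for B
    proof -
      have "g -` (A \<inter> B) \<inter> space borel \<in> sets borel" by measurable
      then show ?thesis unfolding im using borel_compact[OF cmp] by auto
    qed
    note [measurable] = im_borel[of UNIV, simplified]
    have N_eq: "N t = f (g t) * indicator (\<phi> ` A) t" for t
    proof (cases "t \<in> \<phi> ` A")
      case True
      then obtain x where x: "x \<in> A" "t = \<phi> x" by auto
      then have "{z \<in> A. \<phi> z = t} = {x}" using inj A(2) by (auto dest: inj_onD)
      then show ?thesis unfolding N_def using x g A(2) by (auto simp: nn_integral_count_space_indicator[symmetric] nn_integral_count_space_finite)
    next
      case False
      then have "{z \<in> A. \<phi> z = t} = {}" by auto
      then show ?thesis unfolding N_def using False by simp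
    qed
    have N1: "N \<in> borel_measurable borel" unfolding N_eq[abs_def] by measurable
    \<comment> \<open>The measure \<open>\<nu>\<close> is Lebesgue measure on the image transported
      to \<open>A\<close>, and \<open>\<rho>\<close> is Hausdorff measure on \<open>A\<close>; they
      are compared set by set.\<close>
    define \<nu> where "\<nu> = distr (density lborel (indicator (\<phi> ` A))) borel g"
    define \<rho> where "\<rho> = density hausdorff1 (indicator A :: 'a \<Rightarrow> ennreal)"
    have \<nu>: "emeasure \<nu> B = emeasure lborel (\<phi> ` (A \<inter> B))" if [measurable]: "B \<in> sets borel" for B
    proof -
      have "g -` B \<in> sets borel" using measurable_sets_borel[of g borel B] by simp
      then have "emeasure \<nu> B = emeasure lborel (\<phi> ` A \<inter> g -` B)"
        unfolding \<nu>_def by (subst emeasure_distr) (auto intro!: emeasure_restricted)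
      also have "\<phi> ` A \<inter> g -` B = \<phi> ` (A \<inter> B)" using A(2) g by force
      finally show ?thesis .
    qed
    have \<rho>: "emeasure \<rho> B = emeasure hausdorff1 (A \<inter> B)" if [measurable]: "B \<in> sets borel" for B
      unfolding \<rho>_def by (subst emeasure_restricted) auto
    have up: "emeasure lborel (\<phi> ` B) \<le> ennreal b * emeasure hausdorff1 B"
      if "B \<subseteq> A" "B \<in> sets borel" for B
    proof -
      have "\<phi> ` B \<in> sets borel" using im_borel[OF that(2)] that(1) by (simp add: Int_absorb1)
      then have "emeasure lborel (\<phi> ` B) = hausdorff1_outer (\<phi> ` B)"
        by (simp add: hausdorff1_real[symmetric] emeasure_hausdorff1)
      also have "\<dots> \<le> ennreal b * hausdorff1_outer B"
        using bilip that A(2) b by (intro hausdorff1_outer_lipschitz_image) blast+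
      finally show ?thesis using that by (simp add: emeasure_hausdorff1)
    qed
    have lo: "ennreal a * emeasure hausdorff1 B \<le> emeasure lborel (\<phi> ` B)"
      if "B \<subseteq> A" "B \<in> sets borel" for B
    proof -
      have "\<phi> ` B \<in> sets borel" using im_borel[OF that(2)] that(1) by (simp add: Int_absorb1)
      then have eq: "emeasure lborel (\<phi> ` B) = hausdorff1_outer (\<phi> ` B)"
        by (simp add: hausdorff1_real[symmetric] emeasure_hausdorff1)
      have gB: "g ` \<phi> ` B = B" using that(1) A(2) g by force
      have "hausdorff1_outer (g ` \<phi> ` B) \<le> ennreal (1 / a) * hausdorff1_outer (\<phi> ` B)"
      proof (rule hausdorff1_outer_lipschitz_image)
        fix s t assume "s \<in> \<phi> ` B" "t \<in> \<phi> ` B"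
        then obtain x y where xy: "x \<in> B" "y \<in> B" "s = \<phi> x" "t = \<phi> y" by auto
        then have "x \<in> K" "y \<in> K" using that A(2) by auto
        then show "dist (g s) (g t) \<le> 1 / a * dist s t"
          using bilip[of x y] ab(1) xy by (simp add: g field_simps)
      qed (use ab in auto)
      then have "ennreal a * hausdorff1_outer B \<le> ennreal a * (ennreal (1 / a) * hausdorff1_outer (\<phi> ` B))"
        unfolding gB by (rule mult_left_mono) simp
      also have "\<dots> = hausdorff1_outer (\<phi> ` B)"
        using ab(1) by (simp add: mult.assoc[symmetric] ennreal_mult[symmetric])
      finally show ?thesis using that eq by (simp add: emeasure_hausdorff1)
    qed
    have sets_eq [simp]: "sets \<nu> = sets borel" "sets \<rho> = sets borel" unfolding \<nu>_def \<rho>_def by auto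
    have f_\<rho>: "f \<in> borel_measurable \<rho>"
      unfolding measurable_cong_sets[OF sets_eq(2) refl] by (rule meas)
    have "\<nu> \<le> scale_measure (ennreal b) \<rho>"
      by (subst le_measure) (auto intro!: le_funI simp: \<nu> \<rho> up)
    then have "integral\<^sup>N \<nu> f \<le> integral\<^sup>N (scale_measure (ennreal b) \<rho>) f"
      by (intro nn_integral_mono_measure) auto
    then have I1: "integral\<^sup>N \<nu> f \<le> ennreal b * integral\<^sup>N \<rho> f"
      by (simp only: nn_integral_scale_measure[OF f_\<rho>])
    have "scale_measure (ennreal a) \<rho> \<le> \<nu>"
      by (subst le_measure) (auto intro!: le_funI simp: \<nu> \<rho> lo)
    then have "integral\<^sup>N (scale_measure (ennreal a) \<rho>) f \<le> integral\<^sup>N \<nu> f"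
      by (intro nn_integral_mono_measure) auto
    then have I2: "ennreal a * integral\<^sup>N \<rho> f \<le> integral\<^sup>N \<nu> f"
      by (simp only: nn_integral_scale_measure[OF f_\<rho>])
    have IN: "integral\<^sup>N \<nu> f = integral\<^sup>N lborel N"
      unfolding \<nu>_def N_eq[abs_def]
      by (subst nn_integral_distr) (auto simp: nn_integral_density mult.commute)
    have I\<rho>: "integral\<^sup>N \<rho> f = (\<integral>\<^sup>+z. f z * indicator A z \<partial>hausdorff1)"
      unfolding \<rho>_def by (subst nn_integral_density) (auto simp: mult.commute)
    have W1: "ennreal a * integral\<^sup>N \<rho> f \<le> (\<integral>\<^sup>+z. f z * ennreal (w z) * indicator A z \<partial>hausdorff1)"
    proof -
      have "ennreal a * integral\<^sup>N \<rho> f = (\<integral>\<^sup>+z. ennreal a * (f z * indicator A z) \<partial>hausdorff1)"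
        unfolding I\<rho> by (rule nn_integral_cmult[symmetric]) measurable
      also have "\<dots> \<le> (\<integral>\<^sup>+z. f z * ennreal (w z) * indicator A z \<partial>hausdorff1)"
        using w by (intro nn_integral_mono)
          (auto simp: indicator_def mult.commute[of _ "f _"] intro!: mult_left_mono ennreal_leI)
      finally show ?thesis .
    qed
    have W2: "(\<integral>\<^sup>+z. f z * ennreal (w z) * indicator A z \<partial>hausdorff1) \<le> ennreal b * integral\<^sup>N \<rho> f"
    proof -
      have "(\<integral>\<^sup>+z. f z * ennreal (w z) * indicator A z \<partial>hausdorff1)
          \<le> (\<integral>\<^sup>+z. ennreal b * (f z * indicator A z) \<partial>hausdorff1)"
        using w by (intro nn_integral_mono)
          (auto simp: indicator_def mult.commute[of _ "f _"] intro!: mult_left_mono ennreal_leI)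
      also have "\<dots> = ennreal b * integral\<^sup>N \<rho> f"
        unfolding I\<rho> by (rule nn_integral_cmult) measurable
      finally show ?thesis .
    qed
    \<comment> \<open>One side loses the factor \<open>b\<close> and gains \<open>a\<close>, so only
      the ratio \<open>q\<close> remains.\<close>
    have ba: "ennreal b * x \<le> ennreal q * (ennreal a * x)" for x
      using ab by (auto simp: mult.assoc[symmetric] ennreal_mult[symmetric] intro!: mult_right_mono ennreal_leI)
    show ?thesis
      using N1 order_trans[OF I1 order_trans[OF ba mult_left_mono[OF W1]]]
        order_trans[OF W2 order_trans[OF ba mult_left_mono[OF I2]]]
      unfolding IN by auto
  qed
  show "N \<in> borel_measurable borel"
    and "integral\<^sup>N lborel N \<le> ennreal q * (\<integral>\<^sup>+z. f z * ennreal (w z) * indicator A z \<partial>hausdorff1)"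
    and "(\<integral>\<^sup>+z. f z * ennreal (w z) * indicator A z \<partial>hausdorff1) \<le> ennreal q * integral\<^sup>N lborel N"
    using nonempty by (cases "A = {}"; simp add: N_def)+
qed

text \<open>Near \<open>z0\<close> the map is almost the similarity with factor
  \<open>h' z0\<close>: the difference of the two has a small derivative, so by the mean value
  inequality on a convex ball it has a small Lipschitz constant.\<close>

lemma C1_almost_similarity:
  fixes h h' :: "complex \<Rightarrow> complex" and q :: real
  assumes W: "open W" "z0 \<in> W"
    and h: "\<And>z. z \<in> W \<Longrightarrow> (h has_field_derivative h' z) (at z)" "continuous_on W h'"
    and nz: "h' z0 \<noteq> 0" and q: "q > 1"
  obtains r a b where "0 < r" "0 < a" "b \<le> q * a" "cball z0 r \<subseteq> W"
    "\<And>x y. x \<in> cball z0 r \<Longrightarrow> y \<in> cball z0 r \<Longrightarrow>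
        a * dist x y \<le> dist (h x) (h y) \<and> dist (h x) (h y) \<le> b * dist x y"
    "\<And>x. x \<in> cball z0 r \<Longrightarrow> a \<le> cmod (h' x) \<and> cmod (h' x) \<le> b"
proof -
  define c where "c = cmod (h' z0)"
  have "c > 0" unfolding c_def using nz by simp
  \<comment> \<open>Chosen so that \<open>(1 + \<epsilon>) / (1 - \<epsilon>) = q\<close>.\<close>
  define \<epsilon> where "\<epsilon> = (q - 1) / (q + 1)"
  have \<epsilon>: "0 < \<epsilon>" "\<epsilon> < 1" "1 + \<epsilon> = q * (1 - \<epsilon>)"
    unfolding \<epsilon>_def using q by (auto simp: field_simps)
  have "isCont h' z0" using W h(2) continuous_on_eq_continuous_at by blast
  moreover have "0 < \<epsilon> * c" using \<epsilon> \<open>c > 0\<close> by simp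
  ultimately obtain d where d: "d > 0" "\<And>x. dist x z0 < d \<Longrightarrow> dist (h' x) (h' z0) < \<epsilon> * c"
    unfolding continuous_at_eps_delta by metis
  obtain r' where r': "r' > 0" "cball z0 r' \<subseteq> W" using W open_contains_cball by blast
  define r where "r = min r' (d / 2)"
  have r: "r > 0" "cball z0 r \<subseteq> W" "\<And>x. x \<in> cball z0 r \<Longrightarrow> cmod (h' x - h' z0) \<le> \<epsilon> * c"
  proof -
    show "r > 0" using r' d unfolding r_def by auto
    show "cball z0 r \<subseteq> W" using r' unfolding r_def by auto
    fix x assume "x \<in> cball z0 r"
    then have "dist x z0 < d" using d(1) unfolding r_def by (auto simp: dist_commute)
    then show "cmod (h' x - h' z0) \<le> \<epsilon> * c" using d(2)[of x] by (simp add: dist_norm)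
  qed
  show ?thesis
  proof (rule that[of r "(1 - \<epsilon>) * c" "(1 + \<epsilon>) * c"])
    fix x y assume xy: "x \<in> cball z0 r" "y \<in> cball z0 r"
    have "cmod ((h x - h' z0 * x) - (h y - h' z0 * y)) \<le> \<epsilon> * c * cmod (x - y)"
    proof (rule field_differentiable_bound[OF convex_cball])
      fix z assume z: "z \<in> cball z0 r"
      then have "(h has_field_derivative h' z) (at z)"
        using r(2) by (intro h) auto
      then show "((\<lambda>x. h x - h' z0 * x) has_field_derivative (h' z - h' z0)) (at z within cball z0 r)"
        by (auto intro!: derivative_eq_intros intro: has_field_derivative_at_within)
      show "cmod (h' z - h' z0) \<le> \<epsilon> * c" using z by (rule r)
    qed (use xy in auto)
    also have "(h x - h' z0 * x) - (h y - h' z0 * y) = (h x - h y) - h' z0 * (x - y)"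
      by (simp add: algebra_simps)
    finally have *: "cmod ((h x - h y) - h' z0 * (x - y)) \<le> \<epsilon> * c * cmod (x - y)" .
    have "cmod (h' z0 * (x - y)) = c * cmod (x - y)" by (simp add: norm_mult c_def)
    then have "c * cmod (x - y) - cmod (h x - h y) \<le> \<epsilon> * c * cmod (x - y)"
      "cmod (h x - h y) - c * cmod (x - y) \<le> \<epsilon> * c * cmod (x - y)"
      using * norm_triangle_ineq2[of "h' z0 * (x - y)" "h x - h y"]
        norm_triangle_ineq2[of "h x - h y" "h' z0 * (x - y)"]
      by (auto simp: norm_minus_commute)
    then show "(1 - \<epsilon>) * c * dist x y \<le> dist (h x) (h y) \<and> dist (h x) (h y) \<le> (1 + \<epsilon>) * c * dist x y"
      by (auto simp: dist_norm algebra_simps)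
  next
    fix x assume "x \<in> cball z0 r"
    then have "cmod (h' x - h' z0) \<le> \<epsilon> * c" by (rule r)
    then have "c - cmod (h' x) \<le> \<epsilon> * c" "cmod (h' x) - c \<le> \<epsilon> * c"
      using norm_triangle_ineq2[of "h' z0" "h' x"] norm_triangle_ineq2[of "h' x" "h' z0"]
      unfolding c_def by (auto simp: norm_minus_commute)
    then show "(1 - \<epsilon>) * c \<le> cmod (h' x) \<and> cmod (h' x) \<le> (1 + \<epsilon>) * c"
      by (auto simp: algebra_simps)
  qed (use r \<epsilon> \<open>c > 0\<close> in auto)
qed

text \<open>Since \<open>h\<close> is real on \<open>L \<inter> W\<close>, its real part loses no
  distances there and serves as a coordinate along the curve. A multiplicative error
  \<open>q\<close> on each of countably many pieces remains the error \<open>q\<close> for their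
  sum, and \<open>q > 1\<close> is arbitrary. The weight \<open>w\<close> is kept apart from
  \<open>cmod h'\<close> because \<open>h'\<close> is controlled on \<open>W\<close> only, while
  measurability is asked on the whole plane.\<close>

theorem area_formula_level_curve:
  fixes h h' :: "complex \<Rightarrow> complex" and f :: "complex \<Rightarrow> ennreal" and w :: "complex \<Rightarrow> real"
  assumes W: "open W" and L: "closed L"
    and h: "\<And>z. z \<in> W \<Longrightarrow> (h has_field_derivative h' z) (at z)" "continuous_on W h'"
    and nz: "\<And>z. z \<in> L \<inter> W \<Longrightarrow> h' z \<noteq> 0"
    and real: "\<And>z. z \<in> L \<inter> W \<Longrightarrow> h z \<in> \<real>"
    and w: "\<And>z. z \<in> L \<inter> W \<Longrightarrow> w z = cmod (h' z)"
    and meas [measurable]: "f \<in> borel_measurable borel" "w \<in> borel_measurable borel"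
  defines "N \<equiv> \<lambda>t. \<integral>\<^sup>+z. f z * indicator {z \<in> L \<inter> W. Re (h z) = t} z \<partial>count_space UNIV"
  shows "N \<in> borel_measurable borel"
    and "(\<integral>\<^sup>+z. f z * ennreal (w z) * indicator (L \<inter> W) z \<partial>hausdorff1) = integral\<^sup>N lborel N"
proof -
  let ?E = "L \<inter> W"
  let ?I = "\<lambda>A. \<integral>\<^sup>+z. f z * ennreal (w z) * indicator A z \<partial>hausdorff1"
  have E [measurable]: "?E \<in> sets borel" using W L by auto
  have main: "N \<in> borel_measurable borel \<and> integral\<^sup>N lborel N \<le> ennreal q * ?I ?E
      \<and> ?I ?E \<le> ennreal q * integral\<^sup>N lborel N" if q: "q > 1" for q
  proof (cases "?E = {}")
    case True
    then show ?thesis by (simp add: N_def)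
  next
    case False
    have "\<exists>r a b. 0 < r \<and> 0 < a \<and> b \<le> q * a \<and> cball z0 r \<subseteq> W \<and>
       (\<forall>x\<in>cball z0 r. \<forall>y\<in>cball z0 r. a * dist x y \<le> dist (h x) (h y) \<and> dist (h x) (h y) \<le> b * dist x y) \<and>
       (\<forall>x\<in>cball z0 r. a \<le> cmod (h' x) \<and> cmod (h' x) \<le> b)" if "z0 \<in> ?E" for z0
    proof -
      from that have "z0 \<in> W" by simp
      from C1_almost_similarity[OF W this h nz[OF that] q] show ?thesis by metis
    qed
    then obtain r a b where rab: "\<And>z0. z0 \<in> ?E \<Longrightarrow> 0 < r z0 \<and> 0 < a z0 \<and> b z0 \<le> q * a z0 \<and>
       cball z0 (r z0) \<subseteq> W \<and>
       (\<forall>x\<in>cball z0 (r z0). \<forall>y\<in>cball z0 (r z0).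
          a z0 * dist x y \<le> dist (h x) (h y) \<and> dist (h x) (h y) \<le> b z0 * dist x y) \<and>
       (\<forall>x\<in>cball z0 (r z0). a z0 \<le> cmod (h' x) \<and> cmod (h' x) \<le> b z0)" by metis
    define F where "F = (\<lambda>z. ball z (r z)) ` ?E"
    \<comment> \<open>Every point has its own good ball; Lindelof's theorem leaves countably many of
      them.\<close>
    obtain F' where F': "F' \<subseteq> F" "countable F'" "\<Union>F' = \<Union>F"
      using Lindelof[of F] unfolding F_def by auto
    have "?E \<subseteq> \<Union>F" unfolding F_def using rab by force
    then have "F' \<noteq> {}" using False F'(3) by auto
    define U where "U = from_nat_into F'"
    have rangeU: "range U = F'"
      unfolding U_def using F'(2) \<open>F' \<noteq> {}\<close> by (rule range_from_nat_into[rotated])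
    have "\<exists>z\<in>?E. U n = ball z (r z)" for n
      using rangeU F'(1) unfolding F_def by blast
    then obtain c where c: "\<And>n. c n \<in> ?E" "\<And>n. U n = ball (c n) (r (c n))" by metis
    have EU: "?E \<subseteq> (\<Union>n. U n)" using \<open>?E \<subseteq> \<Union>F\<close> F'(3) rangeU by simp
    \<comment> \<open>Disjoint pieces, so that fibre sums and integrals over the curve both become
      series over \<open>n\<close>.\<close>
    define A where "A n = ?E \<inter> disjointed U n" for n
    have A_borel [measurable]: "A n \<in> sets borel" for n
      unfolding A_def disjointed_def using c(2) by auto
    have AU: "A n \<subseteq> ?E \<inter> ball (c n) (r (c n))" for n
      using disjointed_subset[of U n] c(2) unfolding A_def by auto
    have disj: "disjoint_family A"
      using disjoint_family_disjointed[of U] unfolding A_def disjoint_family_on_def by blast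
    have UA: "(\<Union>n. A n) = ?E"
      using EU unfolding A_def Int_UN_distrib[symmetric] UN_disjointed_eq by auto
    define Nn where "Nn n t = (\<integral>\<^sup>+z. f z * indicator {z \<in> A n. Re (h z) = t} z \<partial>count_space UNIV)" for n t
    have piece: "Nn n \<in> borel_measurable borel" "integral\<^sup>N lborel (Nn n) \<le> ennreal q * ?I (A n)"
      "?I (A n) \<le> ennreal q * integral\<^sup>N lborel (Nn n)" for n
    proof -
      \<comment> \<open>Closedness of \<open>L\<close> makes this compact. It lies inside
        \<open>W\<close>, where \<open>h\<close> is real on \<open>L\<close>, so distances of
        \<open>h\<close> are distances of \<open>Re h\<close>.\<close>
      let ?K = "L \<inter> cball (c n) (r (c n))"
      note R = rab[OF c(1)[of n]]
      have K: "compact ?K" using L by (simp add: closed_Int_compact)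
      have AK: "A n \<subseteq> ?K" using AU by force
      have bl: "a (c n) * dist x y \<le> dist (Re (h x)) (Re (h y)) \<and>
          dist (Re (h x)) (Re (h y)) \<le> b (c n) * dist x y" if "x \<in> ?K" "y \<in> ?K" for x y
      proof -
        have "x \<in> ?E" "y \<in> ?E" using that R by auto
        then have "h x = of_real (Re (h x))" "h y = of_real (Re (h y))"
          using real by (metis of_real_Re)+
        then have "dist (h x) (h y) = dist (Re (h x)) (Re (h y))"
          by (metis dist_of_real)
        moreover have "a (c n) * dist x y \<le> dist (h x) (h y) \<and> dist (h x) (h y) \<le> b (c n) * dist x y"
          using R that by blast
        ultimately show ?thesis by simp
      qed
      have wb: "a (c n) \<le> w x \<and> w x \<le> b (c n)" if "x \<in> A n" for x
      proof -
        have "x \<in> ?E" "x \<in> cball (c n) (r (c n))" using that AU[of n] by auto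
        then show ?thesis using R w by auto
      qed
      show "Nn n \<in> borel_measurable borel" "integral\<^sup>N lborel (Nn n) \<le> ennreal q * ?I (A n)"
        "?I (A n) \<le> ennreal q * integral\<^sup>N lborel (Nn n)"
        unfolding Nn_def[abs_def]
        using area_formula_bilipschitz[OF K A_borel AK, of "a (c n)" q "b (c n)" "\<lambda>z. Re (h z)" w f] R q bl wb
        by auto
    qed
    note [measurable] = piece(1)
    have ind: "f z * indicator {z \<in> ?E. Re (h z) = t} z = (\<Sum>n. f z * indicator {z \<in> A n. Re (h z) = t} z)" for z t
    proof -
      have "disjoint_family (\<lambda>n. {z \<in> A n. Re (h z) = t})"
        using disj unfolding disjoint_family_on_def by blast
      then have "(\<Sum>n. indicator {z \<in> A n. Re (h z) = t} z) = (indicator (\<Union>n. {z \<in> A n. Re (h z) = t}) z :: ennreal)"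
        by (rule suminf_indicator)
      also have "(\<Union>n. {z \<in> A n. Re (h z) = t}) = {z \<in> ?E. Re (h z) = t}" using UA by auto
      finally show ?thesis by simp
    qed
    have N_sum: "N t = (\<Sum>n. Nn n t)" for t
      unfolding N_def Nn_def ind by (rule nn_integral_suminf) simp
    have I_sum: "?I ?E = (\<Sum>n. ?I (A n))"
    proof -
      have "?I ?E = (\<integral>\<^sup>+z. (\<Sum>n. f z * ennreal (w z) * indicator (A n) z) \<partial>hausdorff1)"
        unfolding UA[symmetric] by (simp add: suminf_indicator[OF disj])
      also have "\<dots> = (\<Sum>n. ?I (A n))"
        by (rule nn_integral_suminf) measurable
      finally show ?thesis .
    qed
    have NN: "integral\<^sup>N lborel N = (\<Sum>n. integral\<^sup>N lborel (Nn n))"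
      unfolding N_sum[abs_def] by (rule nn_integral_suminf) measurable
    have "N \<in> borel_measurable borel" unfolding N_sum[abs_def] by measurable
    moreover have "integral\<^sup>N lborel N \<le> ennreal q * ?I ?E"
      unfolding NN I_sum ennreal_suminf_cmult[symmetric] by (intro suminf_le piece) auto
    moreover have "?I ?E \<le> ennreal q * integral\<^sup>N lborel N"
      unfolding NN I_sum ennreal_suminf_cmult[symmetric] by (intro suminf_le piece) auto
    ultimately show ?thesis by blast
  qed
  from main[of 2] show "N \<in> borel_measurable borel" by simp
  show "?I ?E = integral\<^sup>N lborel N"
    using main by (blast intro: antisym ennreal_le_of_le_mult)
qed

section \<open>Integrability of the logarithm of a polynomial on the circle\<close>

text \<open>The antiderivative \<open>G\<close> is continuous even at \<open>c\<close>, because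
  \<open>y * ln y\<close> tends to 0, so the fundamental theorem applies with the exceptional point
  \<open>c\<close>. That yields a gauge integral; a one-sided bound upgrades it to Lebesgue
  integrability.\<close>

lemma set_integrable_ln_abs_diff:
  fixes a b c :: real
  shows "set_integrable lborel {a..b} (\<lambda>x. ln \<bar>x - c\<bar>)"
proof (cases "a \<le> b")
  case True
  define G where "G x = (x - c) * ln \<bar>x - c\<bar> - (x - c)" for x
  have lim: "((\<lambda>y::real. y * ln \<bar>y\<bar>) \<longlongrightarrow> 0) (at 0)"
    by (rule filterlim_split_at; real_asymp)
  have "isCont (\<lambda>y::real. y * ln \<bar>y\<bar>) y" for y
  proof (cases "y = 0")
    case True
    then show ?thesis using lim by (simp add: isCont_def)
  next
    case False
    then show ?thesis by (intro continuous_intros) auto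
  qed
  then have "isCont (\<lambda>x. (x - c) * ln \<bar>x - c\<bar>) x" for x
    using isCont_o2[of x "\<lambda>x. x - c" "\<lambda>y. y * ln \<bar>y\<bar>"] by simp
  then have cont: "continuous_on {a..b} G"
    unfolding G_def by (intro continuous_at_imp_continuous_on ballI isCont_diff) auto
  have der: "(G has_real_derivative ln \<bar>x - c\<bar>) (at x)" if "x \<noteq> c" for x
  proof (cases "x > c")
    case True
    have "((\<lambda>x. (x - c) * ln (x - c) - (x - c)) has_real_derivative ln \<bar>x - c\<bar>) (at x)"
      using True by (auto intro!: derivative_eq_intros)
    then show ?thesis
      by (rule has_field_derivative_transform_within_open[of _ _ _ "{c<..}"]) (use True in \<open>auto simp: G_def\<close>)
  next
    case False
    with that have "x < c" by simp
    have "((\<lambda>x. (x - c) * ln (c - x) - (x - c)) has_real_derivative ln \<bar>x - c\<bar>) (at x)"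
      using \<open>x < c\<close> by (auto intro!: derivative_eq_intros simp: divide_simps)
    then show ?thesis
      by (rule has_field_derivative_transform_within_open[of _ _ _ "{..<c}"]) (use \<open>x < c\<close> in \<open>auto simp: G_def\<close>)
  qed
  have int: "((\<lambda>x. ln \<bar>x - c\<bar>) has_integral (G b - G a)) {a..b}"
    using True cont der
    by (intro fundamental_theorem_of_calculus_interior_strong[of "{c}"])
       (auto simp: has_real_derivative_iff_has_vector_derivative[symmetric])
  \<comment> \<open>\<open>K\<close> bounds \<open>\<bar>x - c\<bar>\<close> on the interval, hence
    also the logarithm; at \<open>x = c\<close> the default \<open>ln 0 = 0\<close> is covered by
    \<open>K \<ge> 0\<close>.\<close>
  define K where "K = \<bar>a - c\<bar> + \<bar>b - c\<bar>"
  have K: "0 \<le> K - ln \<bar>x - c\<bar>" if "x \<in> {a..b}" for x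
  proof (cases "x = c")
    case False
    then have "ln \<bar>x - c\<bar> \<le> \<bar>x - c\<bar> - 1" by (intro ln_le_minus_one) auto
    then show ?thesis using that unfolding K_def by auto
  qed (auto simp: K_def)
  have "(\<lambda>x. K - ln \<bar>x - c\<bar>) integrable_on {a..b}"
    using int by (intro integrable_diff integrable_const_ivl) (auto simp: integrable_on_def)
  then have "(\<lambda>x. K - ln \<bar>x - c\<bar>) absolutely_integrable_on {a..b}"
    using K by (intro nonnegative_absolutely_integrable_1) auto
  then have "set_integrable lborel {a..b} (\<lambda>x. K - ln \<bar>x - c\<bar>)"
    unfolding set_integrable_def by (subst (asm) integrable_completion) auto
  moreover have "set_integrable lborel {a..b} (\<lambda>x. K)"
    by (intro borel_integrable_atLeastAtMost') auto
  ultimately show ?thesis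
    using set_integral_diff(1)[of lborel "{a..b}" "\<lambda>x. K" "\<lambda>x. K - ln \<bar>x - c\<bar>"] by simp
qed (simp add: set_integrable_def)

text \<open>Up to \<open>pi / 3\<close> the derivative \<open>cos - 1/2\<close> is nonnegative;
  beyond it, \<open>x / 2 \<le> pi / 4 < sqrt 3 / 2\<close>. Any positive slope would serve, since
  the bound only feeds an integrability estimate.\<close>

lemma half_le_sin:
  fixes x :: real
  assumes "0 \<le> x" "x \<le> pi / 2"
  shows "x / 2 \<le> sin x"
proof (cases "x \<le> pi / 3")
  case True
  have "sin 0 - 0 / 2 \<le> sin x - x / 2"
  proof (rule DERIV_nonneg_imp_nondecreasing[of 0 x "\<lambda>x. sin x - x / 2"])
    fix y assume y: "0 \<le> y" "y \<le> x"
    have "cos (pi / 3) \<le> cos y" using y True by (intro cos_monotone_0_pi_le) auto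
    then have "0 \<le> cos y - 1 / 2" by (simp add: cos_60)
    then show "\<exists>d. ((\<lambda>x. sin x - x / 2) has_real_derivative d) (at y) \<and> 0 \<le> d"
      by (intro exI[of _ "cos y - 1 / 2"]) (auto intro!: derivative_eq_intros)
  qed (use assms in auto)
  then show ?thesis by simp
next
  case False
  have "x / 2 \<le> 4 / 5" using assms pi_approx by (simp add: field_simps)
  also have "4 / 5 \<le> sqrt 3 / 2"
    using real_le_rsqrt[of "8 / 5" 3] by (simp add: power2_eq_square)
  also have "\<dots> = sin (pi / 3)" by (simp add: sin_60)
  also have "\<dots> \<le> sin x" using assms False by (intro sin_monotone_2pi_le) auto
  finally show ?thesis .
qed

text \<open>The zeros of the sine in this range are \<open>0\<close>, \<open>pi\<close> and
  \<open>- pi\<close>, and near each of them the sine is comparable to the distance. All three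
  logarithms are added to get one integrable majorant without cases. At the zeros themselves
  \<open>ln 0 = 0\<close>.\<close>

lemma abs_ln_sin_le:
  fixes y :: real
  assumes "\<bar>y\<bar> \<le> pi"
  shows "\<bar>ln \<bar>sin y\<bar>\<bar> \<le> ln 2 + \<bar>ln \<bar>y\<bar>\<bar> + \<bar>ln \<bar>y - pi\<bar>\<bar> + \<bar>ln \<bar>y + pi\<bar>\<bar>"
proof (cases "sin y = 0")
  case False
  have *: "\<bar>ln \<bar>sin y\<bar>\<bar> \<le> ln 2 + \<bar>ln \<bar>x\<bar>\<bar>" if x: "\<bar>x\<bar> \<le> pi / 2" "\<bar>sin y\<bar> = \<bar>sin x\<bar>" for x
  proof -
    have "x \<noteq> 0" using x False by auto
    have "\<bar>sin x\<bar> = sin \<bar>x\<bar>"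
      using x(1) sin_ge_zero[of "\<bar>x\<bar>"] by (auto simp: abs_if)
    then have "\<bar>x\<bar> / 2 \<le> \<bar>sin y\<bar>" using half_le_sin[of "\<bar>x\<bar>"] x by simp
    then have "ln (\<bar>x\<bar> / 2) \<le> ln \<bar>sin y\<bar>" using \<open>x \<noteq> 0\<close> False by (subst ln_le_cancel_iff) auto
    moreover have "ln (\<bar>x\<bar> / 2) = ln \<bar>x\<bar> - ln 2" using \<open>x \<noteq> 0\<close> by (simp add: ln_div)
    moreover have "ln \<bar>sin y\<bar> \<le> 0" using False by (simp add: abs_sin_le_one)
    ultimately show ?thesis by linarith
  qed
  define a b c where "a = \<bar>ln \<bar>y\<bar>\<bar>" and "b = \<bar>ln \<bar>y - pi\<bar>\<bar>" and "c = \<bar>ln \<bar>y + pi\<bar>\<bar>"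
  have nonneg: "0 \<le> a" "0 \<le> b" "0 \<le> c" by (auto simp: a_def b_def c_def)
  \<comment> \<open>Every such \<open>y\<close> is within \<open>pi / 2\<close> of one of the three
    zeros, and a shift by \<open>pi\<close> changes only the sign of the sine.\<close>
  consider "\<bar>y\<bar> \<le> pi / 2" | "\<bar>y - pi\<bar> \<le> pi / 2" | "\<bar>y + pi\<bar> \<le> pi / 2"
    using assms by linarith
  then have "\<bar>ln \<bar>sin y\<bar>\<bar> \<le> ln 2 + a \<or> \<bar>ln \<bar>sin y\<bar>\<bar> \<le> ln 2 + b \<or> \<bar>ln \<bar>sin y\<bar>\<bar> \<le> ln 2 + c"
    unfolding a_def b_def c_def by cases (use *[of y] *[of "y - pi"] *[of "y + pi"] in simp_all)
  then show ?thesis unfolding a_def[symmetric] b_def[symmetric] c_def[symmetric] using nonneg by force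
qed simp

text \<open>If \<open>a\<close> is off the circle the integrand is continuous. If
  \<open>a = exp (\<i> * \<alpha>)\<close>, factoring out the exponential of the mean angle turns
  the distance into \<open>2 * \<bar>sin ((t - \<alpha>) / 2)\<bar>\<close>, whose argument stays
  within \<open>[-pi, pi]\<close>.\<close>

lemma set_integrable_ln_cmod_circle_linear:
  "set_integrable lborel {0..2 * pi} (\<lambda>t. ln (cmod (exp (\<i> * of_real t) - a)))"
proof (cases "cmod a = 1")
  case True
  define \<alpha> where "\<alpha> = Arg2pi a"
  have \<alpha>: "0 \<le> \<alpha>" "\<alpha> < 2 * pi" "a = exp (\<i> * of_real \<alpha>)"
    using True Arg2pi[of a] unfolding \<alpha>_def by (auto simp: is_Arg_def)
  have dist: "cmod (exp (\<i> * of_real t) - a) = 2 * \<bar>sin ((t - \<alpha>) / 2)\<bar>" for t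
  proof -
    define s y where "s = (t + \<alpha>) / 2" and "y = (t - \<alpha>) / 2"
    have "t = s + y" "\<alpha> = s - y" by (auto simp: s_def y_def field_simps)
    then have "exp (\<i> * of_real t) - a = exp (\<i> * of_real s) * (exp (\<i> * of_real y) - exp (- (\<i> * of_real y)))"
      unfolding \<alpha>(3) by (simp add: right_diff_distrib flip: exp_add) (simp add: algebra_simps)
    also have "exp (\<i> * of_real y) - exp (- (\<i> * of_real y)) = 2 * \<i> * of_real (sin y)"
      by (simp add: sin_exp_eq field_simps flip: sin_of_real)
    finally show ?thesis by (simp add: norm_mult y_def)
  qed
  \<comment> \<open>The five \<open>ln 2\<close> come from the factor 2 before the sine, from the
    sine estimate, and from halving three arguments.\<close>
  define bd where "bd t = 5 * ln 2 + \<bar>ln \<bar>t - \<alpha>\<bar>\<bar> + \<bar>ln \<bar>t - (\<alpha> + 2 * pi)\<bar>\<bar>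
      + \<bar>ln \<bar>t - (\<alpha> - 2 * pi)\<bar>\<bar>" for t
  have "set_integrable lborel {0..2 * pi} bd"
    unfolding bd_def by (intro set_integral_add set_integrable_abs set_integrable_ln_abs_diff borel_integrable_atLeastAtMost') auto
  then show ?thesis
  proof (rule set_integrable_bound)
    show "AE t in lborel. t \<in> {0..2 * pi} \<longrightarrow> norm (ln (cmod (exp (\<i> * of_real t) - a))) \<le> norm (bd t)"
    proof (intro AE_I2 impI)
      fix t assume t: "t \<in> {0..2 * pi}"
      define y where "y = (t - \<alpha>) / 2"
      have half: "\<bar>ln \<bar>s / 2\<bar>\<bar> \<le> \<bar>ln \<bar>s\<bar>\<bar> + ln 2" for s :: real
        using abs_triangle_ineq4[of "ln \<bar>s\<bar>" "ln 2"] by (cases "s = 0") (auto simp: ln_div)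
      have y2: "y = (t - \<alpha>) / 2" "y - pi = (t - (\<alpha> + 2 * pi)) / 2" "y + pi = (t - (\<alpha> - 2 * pi)) / 2"
        by (auto simp: y_def field_simps)
      have "\<bar>ln (2 * \<bar>sin y\<bar>)\<bar> \<le> ln 2 + \<bar>ln \<bar>sin y\<bar>\<bar>"
        using abs_triangle_ineq[of "ln 2" "ln \<bar>sin y\<bar>"] by (cases "sin y = 0") (simp_all add: ln_mult)
      also have "\<dots> \<le> ln 2 + (ln 2 + \<bar>ln \<bar>y\<bar>\<bar> + \<bar>ln \<bar>y - pi\<bar>\<bar> + \<bar>ln \<bar>y + pi\<bar>\<bar>)"
        using t \<alpha> by (intro add_left_mono abs_ln_sin_le) (auto simp: y_def)
      also have "\<dots> \<le> bd t"
        using add_mono[OF add_mono[OF half[of "t - \<alpha>"] half[of "t - (\<alpha> + 2 * pi)"]] half[of "t - (\<alpha> - 2 * pi)"]]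
        unfolding y2[symmetric] bd_def by simp
      finally show "norm (ln (cmod (exp (\<i> * of_real t) - a))) \<le> norm (bd t)"
        unfolding dist y_def by simp
    qed
  qed (auto simp: set_borel_measurable_def)
next
  case False
  then have "exp (\<i> * of_real t) \<noteq> a" for t :: real by auto
  then show ?thesis
    by (intro borel_integrable_atLeastAtMost' continuous_intros) auto
qed

lemma borel_measurable_poly [measurable]:
  "poly (p :: complex poly) \<in> borel_measurable borel"
  by (intro borel_measurable_continuous_onI continuous_intros)

text \<open>Linear factors are split off one at a time. The estimate of the logarithm of a product
  by the sum of absolute logarithms also holds at zeros, because \<open>ln 0 = 0\<close>.\<close>

lemma set_integrable_ln_cmod_poly_circle:
  fixes p :: "complex poly"
  assumes "p \<noteq> 0"
  shows "set_integrable lborel {0..2 * pi} (\<lambda>t. ln (cmod (poly p (exp (\<i> * of_real t)))))"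
  using assms
proof (induction "degree p" arbitrary: p)
  case 0
  then obtain c where "p = [:c:]" using degree0_coeffs by metis
  then show ?case by (auto intro!: borel_integrable_atLeastAtMost')
next
  case (Suc n)
  then have "\<not> constant (poly p)" by (simp add: constant_degree)
  then obtain a where "poly p a = 0" using fundamental_theorem_of_algebra by blast
  then obtain q where q: "p = [:-a, 1:] * q" by (metis poly_eq_0_iff_dvd dvd_def)
  with Suc have "q \<noteq> 0" by auto
  then have "degree q = n" using Suc(2) unfolding q by (subst (asm) degree_mult_eq) auto
  then have IH: "set_integrable lborel {0..2 * pi} (\<lambda>t. ln (cmod (poly q (exp (\<i> * of_real t)))))"
    using Suc(1) \<open>q \<noteq> 0\<close> by blast
  have "set_integrable lborel {0..2 * pi} (\<lambda>t. \<bar>ln (cmod (exp (\<i> * of_real t) - a))\<bar> +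
      \<bar>ln (cmod (poly q (exp (\<i> * of_real t))))\<bar>)"
    by (intro set_integral_add set_integrable_abs IH set_integrable_ln_cmod_circle_linear)
  then show ?case
  proof (rule set_integrable_bound)
    show "AE t in lborel. t \<in> {0..2 * pi} \<longrightarrow> norm (ln (cmod (poly p (exp (\<i> * of_real t))))) \<le>
        norm (\<bar>ln (cmod (exp (\<i> * of_real t) - a))\<bar> + \<bar>ln (cmod (poly q (exp (\<i> * of_real t))))\<bar>)"
    proof (intro AE_I2 impI)
      fix t
      let ?u = "exp (\<i> * of_real t) - a" and ?v = "poly q (exp (\<i> * of_real t))"
      have "poly p (exp (\<i> * of_real t)) = ?u * ?v" by (simp add: q algebra_simps)
      then have "norm (ln (cmod (poly p (exp (\<i> * of_real t))))) \<le> \<bar>ln (cmod ?u)\<bar> + \<bar>ln (cmod ?v)\<bar>"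
        by (cases "?u = 0 \<or> ?v = 0") (auto simp: norm_mult ln_mult)
      then show "norm (ln (cmod (poly p (exp (\<i> * of_real t))))) \<le> norm (\<bar>ln (cmod ?u)\<bar> + \<bar>ln (cmod ?v)\<bar>)"
        by simp
    qed
  qed (auto simp: set_borel_measurable_def)
qed

section \<open>The norm polynomial\<close>

lemma cpoly_simps [simp]:
  "cpoly (p + q) z = cpoly p z + cpoly q z"
  "cpoly (p * q) z = cpoly p z * cpoly q z"
  "cpoly [:c:] z = of_int c"
  "cpoly (monom c n) z = of_int c * z ^ n"
proof -
  have "map_poly of_int (p + q) = (map_poly of_int p + map_poly of_int q :: complex poly)"
    "map_poly of_int (p * q) = (map_poly of_int p * map_poly of_int q :: complex poly)"
    by (intro poly_eqI; simp add: coeff_map_poly coeff_mult)+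
  then show "cpoly (p + q) z = cpoly p z + cpoly q z" "cpoly (p * q) z = cpoly p z * cpoly q z"
    by simp_all
qed (simp_all add: map_poly_monom poly_monom map_poly_pCons)

text \<open>Expansion of \<open>F\<close> in base \<open>V\<close>: repeated division by a monic
  polynomial stays within the integers and shows that \<open>1, z, ..., z^(m-1)\<close> generate the
  integer polynomials over those in \<open>V\<close>.\<close>

lemma base_expansion_monic:
  fixes V F :: "int poly"
  assumes "lead_coeff V = 1" "degree V = m" "m \<ge> 1"
  shows "\<exists>r :: nat \<Rightarrow> int poly. \<forall>z. cpoly F z = (\<Sum>k<m. cpoly (r k) (cpoly V z) * z ^ k)"
proof (induction "degree F" arbitrary: F rule: less_induct)
  case less
  show ?case
  proof (cases "degree F < m")
    case True
    have "cpoly F z = (\<Sum>k<m. of_int (coeff F k) * z ^ k)" for z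
    proof -
      have "cpoly F z = (\<Sum>k\<le>degree F. of_int (coeff F k) * z ^ k)"
        by (simp add: poly_altdef coeff_map_poly degree_map_poly)
      also have "\<dots> = (\<Sum>k<m. of_int (coeff F k) * z ^ k)"
        using True by (intro sum.mono_neutral_left) (auto simp: coeff_eq_0)
      finally show ?thesis .
    qed
    then show ?thesis by (intro exI[of _ "\<lambda>k. [:coeff F k:]"]) simp
  next
    case False
    \<comment> \<open>With leading coefficient 1 the scaling factor of pseudo-division is 1, so this
      is division with remainder.\<close>
    obtain G R where GR: "pseudo_divmod F V = (G, R)" by force
    have "V \<noteq> 0" using assms by auto
    from pseudo_divmod[OF this GR] have F: "F = V * G + R" and R: "R = 0 \<or> degree R < degree V"
      using assms by auto
    have "degree R < m" using R assms by auto
    then have "degree R < degree F" using False by simp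
    have "degree G < degree F"
    proof (cases "G = 0")
      case False
      have "V * G = F - R" using F by simp
      then have "degree (V * G) = degree F"
        using \<open>degree R < degree F\<close> degree_add_eq_left[of "-R" F] by simp
      then show ?thesis using False \<open>V \<noteq> 0\<close> assms by (simp add: degree_mult_eq)
    qed (use \<open>degree R < degree F\<close> in auto)
    from less[OF this] obtain g where
      g: "\<And>z. cpoly G z = (\<Sum>k<m. cpoly (g k) (cpoly V z) * z ^ k)" by blast
    from less[OF \<open>degree R < degree F\<close>] obtain r where
      r: "\<And>z. cpoly R z = (\<Sum>k<m. cpoly (r k) (cpoly V z) * z ^ k)" by blast
    \<comment> \<open>Multiplication by \<open>V\<close> multiplies each digit polynomial by its
      variable \<open>monom 1 1\<close>.\<close>
    have "cpoly F z = (\<Sum>k<m. cpoly (monom 1 1 * g k + r k) (cpoly V z) * z ^ k)" for z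
      by (simp add: F g r sum_distrib_left sum.distrib ring_distribs mult.assoc)
    then show ?thesis by (intro exI[of _ "\<lambda>k. monom 1 1 * g k + r k"]) blast
  qed
qed

text \<open>A kernel vector is the coefficient vector of a nonzero polynomial of degree below
  \<open>n\<close> that vanishes at \<open>n\<close> distinct points.\<close>

lemma vandermonde_det_nonzero:
  fixes x :: "nat \<Rightarrow> 'a :: field"
  assumes "inj_on x {..<n}"
  shows "Determinant.det (Matrix.mat n n (\<lambda>(i, k). x i ^ k)) \<noteq> 0"
proof
  let ?B = "Matrix.mat n n (\<lambda>(i, k). x i ^ k)"
  assume "Determinant.det ?B = 0"
  then obtain v where v: "v \<in> carrier_vec n" "v \<noteq> 0\<^sub>v n" "?B *\<^sub>v v = 0\<^sub>v n"
    by (subst (asm) det_0_iff_vec_prod_zero[of _ n]) auto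
  define p where "p = (\<Sum>k<n. monom (vec_index v k) k)"
  have coeff: "coeff p k = vec_index v k" if "k < n" for k
    using that unfolding p_def by (simp add: coeff_sum)
  have root: "poly p (x i) = 0" if "i < n" for i
  proof -
    have "vec_index (?B *\<^sub>v v) i = 0" using that by (subst v(3)) auto
    then show ?thesis using that v(1)
      by (auto simp: p_def poly_sum poly_monom scalar_prod_def mult.commute lessThan_atLeast0)
  qed
  obtain k where k: "k < n" "vec_index v k \<noteq> 0"
    using v(1,2) by (metis carrier_vecD eq_vecI index_zero_vec(1,2))
  then have "p \<noteq> 0" using coeff by fastforce
  have "degree p < n"
    unfolding p_def using k(1) by (intro degree_sum_less order_le_less_trans[OF degree_monom_le]) auto
  have "n = card (x ` {..<n})" using assms by (simp add: card_image)
  also have "\<dots> \<le> card {z. poly p z = 0}"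
    using root \<open>p \<noteq> 0\<close> by (intro card_mono poly_roots_finite) auto
  also have "\<dots> \<le> degree p" using \<open>p \<noteq> 0\<close> by (rule card_poly_roots_bound)
  finally show False using \<open>degree p < n\<close> by simp
qed

text \<open>
  The polynomial is the norm of \<open>P\<close> from \<open>\<int>[w][z]/(V(z) - w)\<close> to \<open>\<int>[w]\<close>, that is, the determinant of
  multiplication by \<open>P\<close> in the basis \<open>1, z, \<dots>, z\<^sup>m\<^sup>-\<^sup>1\<close>.
\<close>

lemma norm_poly_exists:
  fixes V P :: "int poly"
  assumes "lead_coeff V = 1" "degree V = m" "m \<ge> 1"
  obtains Q :: "int poly" where
    "\<And>w. card {z. cpoly V z = w} = m \<Longrightarrow> cpoly Q w = (\<Prod>z | cpoly V z = w. cpoly P z)"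
proof -
  have "\<exists>r :: nat \<Rightarrow> int poly. \<forall>z. z ^ j * cpoly P z = (\<Sum>k<m. cpoly (r k) (cpoly V z) * z ^ k)" for j
    using base_expansion_monic[OF assms, of "monom 1 j * P"] by simp
  then obtain r :: "nat \<Rightarrow> nat \<Rightarrow> int poly" where
    r: "\<And>j z. z ^ j * cpoly P z = (\<Sum>k<m. cpoly (r j k) (cpoly V z) * z ^ k)" by metis
  define A where "A = Matrix.mat m m (\<lambda>(j, k). r j k)"
  show ?thesis
  proof (rule that[of "Determinant.det A"])
    fix w assume card: "card {z. cpoly V z = w} = m"
    then have "finite {z. cpoly V z = w}" using assms by (intro card_ge_0_finite) auto
    then obtain x where x: "bij_betw x {..<m} {z. cpoly V z = w}"
      using ex_bij_betw_nat_finite[of "{z. cpoly V z = w}"] card by (auto simp: lessThan_atLeast0)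
    then have Vx: "cpoly V (x i) = w" if "i < m" for i
      using that by (auto simp: bij_betw_def)
    \<comment> \<open>Evaluation at \<open>w\<close> is a ring homomorphism and so commutes with the
      determinant.\<close>
    interpret ev: comm_ring_hom "\<lambda>p::int poly. cpoly p w"
      by unfold_locales auto
    let ?A = "map_mat (\<lambda>p. cpoly p w) A"
    let ?B = "Matrix.mat m m (\<lambda>(i, k). x i ^ k)"
    let ?D = "Matrix.mat m m (\<lambda>(i, j). if i = j then cpoly P (x i) else 0)"
    \<comment> \<open>For a fibre point \<open>x i\<close>, the vector of its powers is an
      eigenvector of the evaluated multiplication matrix with eigenvalue \<open>P (x i)\<close>.
      Distinct points make the Vandermonde matrix invertible, so it diagonalises the matrix.\<close>
    have "?B * transpose_mat ?A = ?D * ?B"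
    proof (rule eq_matI)
      fix i j assume ij: "i < dim_row (?D * ?B)" "j < dim_col (?D * ?B)"
      then have "(?B * transpose_mat ?A) $$ (i, j) = (\<Sum>k<m. x i ^ k * cpoly (r j k) w)"
        by (simp add: A_def scalar_prod_def lessThan_atLeast0)
      also have "\<dots> = x i ^ j * cpoly P (x i)"
        using ij Vx[of i] by (simp add: r mult.commute)
      also have "\<dots> = (\<Sum>k<m. (if i = k then cpoly P (x i) else 0) * x k ^ j)"
        using ij by (subst sum.remove[of _ i]) (auto simp: mult.commute)
      also have "\<dots> = (?D * ?B) $$ (i, j)"
        using ij by (simp add: scalar_prod_def lessThan_atLeast0)
      finally show "(?B * transpose_mat ?A) $$ (i, j) = (?D * ?B) $$ (i, j)" .
    qed (auto simp: A_def)
    then have "Determinant.det (?B * transpose_mat ?A) = Determinant.det (?D * ?B)" by simp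
    moreover have "Determinant.det (?B * transpose_mat ?A) = Determinant.det ?B * Determinant.det ?A"
      by (subst det_mult[of _ m]) (auto simp: A_def det_transpose[of _ m])
    moreover have "Determinant.det (?D * ?B) = Determinant.det ?D * Determinant.det ?B"
      by (subst det_mult[of _ m]) auto
    moreover have "Determinant.det ?B \<noteq> 0"
      using x by (intro vandermonde_det_nonzero) (auto simp: bij_betw_def)
    ultimately have "Determinant.det ?A = Determinant.det ?D" by simp
    also have "\<dots> = (\<Prod>i<m. cpoly P (x i))"
      by (subst det_upper_triangular[of _ m])
         (auto simp: upper_triangular_def prod_list_diag_prod lessThan_atLeast0)
    also have "\<dots> = (\<Prod>z | cpoly V z = w. cpoly P z)"
      by (rule prod.reindex_bij_betw[OF x])
    finally show "cpoly (Determinant.det A) w = (\<Prod>z | cpoly V z = w. cpoly P z)" by simp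
  qed
qed

section \<open>Integration over the lemniscate\<close>

lemma finite_null_sets_hausdorff1:
  "finite F \<Longrightarrow> F \<in> null_sets (hausdorff1 :: 'a::metric_space measure)"
proof (induction rule: finite_induct)
  case (insert x F)
  have "{x} \<in> null_sets (hausdorff1 :: 'a measure)"
    by (intro null_setsI) (auto simp: emeasure_hausdorff1)
  from null_sets.Un[OF this insert.IH] show ?case by simp
qed auto

lemma pderiv_map_poly_of_int:
  "pderiv (map_poly of_int V) = (map_poly of_int (pderiv V) :: complex poly)"
  by (intro poly_eqI) (simp add: coeff_pderiv coeff_map_poly)

lemma cpoly_map_nonzero: "V \<noteq> 0 \<Longrightarrow> map_poly of_int V \<noteq> (0 :: complex poly)"
  by (metis degree_map_poly leading_coeff_0_iff coeff_map_poly of_int_0 of_int_eq_0_iff)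

lemma degree_cpoly_diff_const:
  assumes "degree V \<ge> 1"
  shows "degree (map_poly of_int V - [:w:] :: complex poly) = degree V"
proof -
  have "degree (map_poly of_int V + [:- w:] :: complex poly) = degree V"
    using assms by (subst degree_add_eq_left) (simp_all add: degree_map_poly)
  moreover have "map_poly of_int V + [:- w:] = (map_poly of_int V - [:w:] :: complex poly)"
    by (simp add: poly_eq_iff coeff_pCons split: nat.split)
  ultimately show ?thesis by simp
qed

lemma finite_cpoly_level:
  assumes "degree V \<ge> 1"
  shows "finite {z. cpoly V z = w}"
proof -
  have "map_poly of_int V - [:w:] \<noteq> 0"
    using degree_cpoly_diff_const[OF assms, of w] assms by (metis degree_0 not_one_le_zero)
  from poly_roots_finite[OF this] show ?thesis by (simp add: algebra_simps)
qed

text \<open>Without critical points in the fibre all roots of \<open>V - w\<close> are simple, so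
  counting with multiplicity and counting points agree.\<close>

lemma card_cpoly_level:
  assumes V: "lead_coeff V = 1" "degree V = m" "m \<ge> 1"
    and nc: "\<And>z. cpoly V z = w \<Longrightarrow> cpoly (pderiv V) z \<noteq> 0"
  shows "card {z. cpoly V z = w} = m"
proof -
  let ?p = "map_poly of_int V - [:w:] :: complex poly"
  have deg: "degree ?p = m"
    using V degree_cpoly_diff_const by simp
  have "poly (pderiv ?p) z = cpoly (pderiv V) z" for z
    by (simp add: pderiv_diff pderiv_map_poly_of_int)
  then have "rsquarefree ?p" unfolding rsquarefree_roots using nc by auto
  moreover have "?p \<noteq> 0" using deg V by auto
  ultimately have "size (proots ?p) = (\<Sum>z | poly ?p z = 0. 1)"
    unfolding size_multiset_overloaded_eq
    by (intro sum.cong) (auto simp: rsquarefree_root_order)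
  then have "card {z. poly ?p z = 0} = degree ?p"
    by (simp add: size_proots_complex)
  then show ?thesis using deg by simp
qed

lemma compact_lemniscate:
  assumes "degree V \<ge> 1"
  shows "compact (lemniscate V)"
proof -
  have "closed (lemniscate V)"
    unfolding lemniscate_def by (intro closed_Collect_eq continuous_intros)
  moreover have "bounded (lemniscate V)"
  proof -
    have "filterlim (cpoly V) at_infinity at_infinity"
      using assms by (intro filterlim_poly_at_infinity) (simp add: degree_map_poly)
    then have "eventually (\<lambda>z. 2 \<le> cmod (cpoly V z)) at_infinity"
      by (simp add: filterlim_at_infinity[OF order_refl])
    then obtain b where "\<And>z. b \<le> cmod z \<Longrightarrow> 2 \<le> cmod (cpoly V z)"
      unfolding eventually_at_infinity by blast
    then have "cmod z \<le> b" if "z \<in> lemniscate V" for z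
      using that unfolding lemniscate_def by (cases "b \<le> cmod z") force+
    then have "lemniscate V \<subseteq> cball 0 b" by auto
    then show ?thesis by (rule bounded_subset[OF bounded_cball])
  qed
  ultimately show ?thesis by (simp add: compact_eq_bounded_closed)
qed

text \<open>
  The area formula is applied to \<open>h = \<pi> - \<i> Ln (-V)\<close>: on the lemniscate \<open>h\<close> is a real argument of \<open>V\<close>,
  lies in \<open>(0, 2\<pi>)\<close> off the finitely many points with \<open>V = 1\<close>, and \<open>|h'| = |V'|\<close>.
\<close>

lemma nn_integral_lemniscate_measure:
  fixes V :: "int poly" and f :: "complex \<Rightarrow> ennreal"
  assumes V: "lead_coeff V = 1" "degree V = m" "m \<ge> 1"
    and f [measurable]: "f \<in> borel_measurable borel"
  shows "(\<integral>\<^sup>+z. f z \<partial>lemniscate_measure V) =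
    ennreal (1 / (2 * pi * real m)) *
      (\<integral>\<^sup>+t. (\<Sum>z | cpoly V z = exp (\<i> * of_real t). f z) * indicator {0..2 * pi} t \<partial>lborel)"
proof -
  define L where "L = lemniscate V"
  define V' where "V' = cpoly (pderiv V)"
  \<comment> \<open>Keeping \<open>V z\<close> away from the nonnegative reals avoids the cut of
    \<open>Ln (- V)\<close> and the zeros of \<open>V\<close> at once; on the lemniscate this
    removes only \<open>V z = 1\<close>.\<close>
  define W where "W = {z. - cpoly V z \<notin> \<real>\<^sub>\<le>\<^sub>0 \<and> V' z \<noteq> 0}"
  define h where "h z = of_real pi - \<i> * Ln (- cpoly V z)" for z
  define h' where "h' z = - \<i> * (V' z / cpoly V z)" for z
  have L: "closed L" using compact_lemniscate V unfolding L_def by (simp add: compact_imp_closed)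
  have contV': "continuous_on A V'" for A unfolding V'_def by (intro continuous_intros)
  have [measurable]: "V' \<in> borel_measurable borel" "L \<in> sets borel"
    unfolding V'_def using L by auto
  have "open {z. - cpoly V z \<notin> \<real>\<^sub>\<le>\<^sub>0}"
  proof -
    have "{z. - cpoly V z \<notin> \<real>\<^sub>\<le>\<^sub>0} = (\<lambda>z. - cpoly V z) -` (- \<real>\<^sub>\<le>\<^sub>0)" by auto
    then show ?thesis
      by (simp only:) (intro open_vimage continuous_intros open_Compl closed_nonpos_Reals_complex)
  qed
  moreover have "open {z. V' z \<noteq> 0}"
    by (intro open_Collect_neq contV' continuous_intros)
  ultimately have W: "open W" unfolding W_def Collect_conj_eq by (rule open_Int)
  have nzW: "cpoly V z \<noteq> 0" if "z \<in> W" for z using that unfolding W_def by auto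
  have dh: "(h has_field_derivative h' z) (at z)" if "z \<in> W" for z
    using that nzW[OF that] unfolding h_def h'_def W_def V'_def
    by (auto intro!: derivative_eq_intros simp: field_simps pderiv_map_poly_of_int)
  have ch': "continuous_on W h'"
    unfolding h'_def using nzW by (intro continuous_intros contV') auto
  have cmod1: "cmod (cpoly V z) = 1" if "z \<in> L" for z using that unfolding L_def lemniscate_def by simp
  have hreal: "h z = of_real (pi + Im (Ln (- cpoly V z)))" "exp (\<i> * h z) = cpoly V z" if "z \<in> L" for z
  proof -
    have nz: "cpoly V z \<noteq> 0" using cmod1[OF that] by auto
    have "Re (Ln (- cpoly V z)) = 0" using cmod1[OF that] nz by simp
    then show "h z = of_real (pi + Im (Ln (- cpoly V z)))" by (simp add: h_def complex_eq_iff)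
    have "\<i> * h z = \<i> * of_real pi + Ln (- cpoly V z)" unfolding h_def by (simp add: algebra_simps)
    then have "exp (\<i> * h z) = exp (\<i> * of_real pi) * exp (Ln (- cpoly V z))" by (simp only: exp_add)
    then show "exp (\<i> * h z) = cpoly V z" using nz by (simp add: exp_Ln)
  qed
  have h_exp: "h z = of_real t" if "0 < t" "t < 2 * pi" "cpoly V z = exp (\<i> * of_real t)" for z t
  proof -
    have "- cpoly V z = exp (\<i> * of_real (t - pi))"
      using that(3) by (simp add: algebra_simps exp_diff)
    moreover have "Ln (exp (\<i> * of_real (t - pi))) = \<i> * of_real (t - pi)"
      using that by (intro Ln_exp) auto
    ultimately have "Ln (- cpoly V z) = \<i> * of_real (t - pi)" by simp
    then show ?thesis unfolding h_def by (simp add: complex_eq_iff)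
  qed
  have Re_h: "0 < Re (h z)" "Re (h z) < 2 * pi" if "z \<in> L \<inter> W" for z
  proof -
    have z: "z \<in> L" "- cpoly V z \<notin> \<real>\<^sub>\<le>\<^sub>0" "- cpoly V z \<noteq> 0" using that nzW unfolding W_def by auto
    have "- pi < Im (Ln (- cpoly V z))" "Im (Ln (- cpoly V z)) \<le> pi"
      using z(3) by (auto intro: mpi_less_Im_Ln Im_Ln_le_pi)
    moreover have "Im (Ln (- cpoly V z)) \<noteq> pi"
      using z(2,3) Im_Ln_eq_pi[of "- cpoly V z"] by (auto simp: complex_nonpos_Reals_iff)
    ultimately show "0 < Re (h z)" "Re (h z) < 2 * pi" unfolding hreal(1)[OF z(1)] by auto
  qed
  \<comment> \<open>The part of the lemniscate outside \<open>W\<close> lies in this finite set,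
    which has length zero.\<close>
  define Z where "Z = {z. cpoly V z = 1} \<union> {z. V' z = 0}"
  have "pderiv V \<noteq> 0" using V by (auto simp: pderiv_eq_0_iff)
  then have finV': "finite {z. V' z = 0}"
    unfolding V'_def by (intro poly_roots_finite cpoly_map_nonzero)
  then have "finite Z" using finite_cpoly_level[of V 1] V unfolding Z_def by simp
  have LW: "L - Z = L \<inter> W"
  proof -
    have "- cpoly V z \<in> \<real>\<^sub>\<le>\<^sub>0 \<longleftrightarrow> cpoly V z = 1" if "z \<in> L" for z
    proof
      assume "- cpoly V z \<in> \<real>\<^sub>\<le>\<^sub>0"
      then have "cpoly V z = of_real (cmod (cpoly V z))"
        by (auto simp: complex_nonpos_Reals_iff complex_eq_iff cmod_eq_Re)
      then show "cpoly V z = 1" using cmod1[OF that] by simp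
    qed (auto simp: complex_nonpos_Reals_iff)
    then show ?thesis unfolding Z_def W_def by auto
  qed
  define N where "N t = (\<integral>\<^sup>+z. f z * indicator {z \<in> L \<inter> W. Re (h z) = t} z \<partial>count_space UNIV)" for t
  have area: "(\<integral>\<^sup>+z. f z * ennreal (cmod (V' z)) * indicator (L \<inter> W) z \<partial>hausdorff1) = integral\<^sup>N lborel N"
    unfolding N_def
  proof (rule area_formula_level_curve(2)[OF W L dh ch'])
    fix z assume z: "z \<in> L \<inter> W"
    show "h' z \<noteq> 0" using z nzW unfolding h'_def W_def by auto
    show "h z \<in> \<real>" using z hreal(1) by (metis IntD1 Reals_of_real)
    show "cmod (V' z) = cmod (h' z)" using z cmod1 unfolding h'_def by (simp add: norm_mult norm_divide)
  qed (auto simp: V'_def)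
  have NAE: "AE t in lborel. N t = (\<Sum>z | cpoly V z = exp (\<i> * of_real t). f z) * indicator {0..2 * pi} t"
  proof -
    \<comment> \<open>For other \<open>t\<close> in the interval the fibre over
      \<open>exp (\<i> * t)\<close> contains no critical point and lies off \<open>V z = 1\<close>,
      so restriction to \<open>W\<close> loses none of its points.\<close>
    have "finite ({0, 2 * pi} \<union> (\<lambda>z. Re (h z)) ` {z. V' z = 0})" using finV' by simp
    then have "AE t in lborel. t \<notin> {0, 2 * pi} \<union> (\<lambda>z. Re (h z)) ` {z. V' z = 0}"
      by (intro AE_not_in finite_imp_null_set_lborel)
    then show ?thesis
    proof eventually_elim
      case (elim t)
      note t = elim
      let ?S = "{z \<in> L \<inter> W. Re (h z) = t}"
      show ?case
      proof (cases "t \<in> {0..2 * pi}")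
        case True
        then have t': "0 < t" "t < 2 * pi" using t by auto
        have "?S = {z. cpoly V z = exp (\<i> * of_real t)}"
        proof safe
          fix z assume "z \<in> L" "z \<in> W" "t = Re (h z)"
          then show "cpoly V z = exp (\<i> * of_real (Re (h z)))" using hreal[of z] by simp
        next
          fix z assume z: "cpoly V z = exp (\<i> * of_real t)"
          from h_exp[OF t' z] show "Re (h z) = t" by simp
          show "z \<in> L" unfolding L_def lemniscate_def by (simp add: z)
          moreover have "z \<notin> Z"
          proof
            assume "z \<in> Z"
            moreover have "V' z \<noteq> 0" using t \<open>Re (h z) = t\<close> by auto
            ultimately have "cpoly V z = 1" unfolding Z_def by auto
            then have "h z = of_real (2 * pi)" unfolding h_def by simp
            then show False using h_exp[OF t' z] t' by (simp add: of_real_eq_iff del: of_real_mult)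
          qed
          ultimately show "z \<in> W" using LW by auto
        qed
        moreover have "finite {z. cpoly V z = exp (\<i> * of_real t)}"
          using finite_cpoly_level V by simp
        ultimately show ?thesis
          using True unfolding N_def
          by (simp add: nn_integral_count_space_indicator[symmetric] nn_integral_count_space_finite)
      next
        case False
        then have "?S = {}" using Re_h by fastforce
        then show ?thesis using False unfolding N_def by simp
      qed
    qed
  qed
  let ?c = "ennreal (1 / (2 * pi * real m))"
  have "(\<integral>\<^sup>+z. f z \<partial>lemniscate_measure V) =
      (\<integral>\<^sup>+z. ennreal (cmod (V' z) / (2 * pi * real m)) * f z * indicator L z \<partial>hausdorff1)"
    unfolding lemniscate_measure_def V'_def L_def[symmetric] V(2)
    by (subst nn_integral_density)
       (auto simp: nn_integral_restrict_space V(2) intro!: measurable_restrict_space1)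
  also have "\<dots> = (\<integral>\<^sup>+z. ?c * (f z * ennreal (cmod (V' z)) * indicator (L \<inter> W) z) \<partial>hausdorff1)"
  proof (rule nn_integral_cong_AE)
    have "AE z in hausdorff1. z \<notin> Z"
      using finite_null_sets_hausdorff1[OF \<open>finite Z\<close>] by (rule AE_not_in)
    then show "AE z in hausdorff1. ennreal (cmod (V' z) / (2 * pi * real m)) * f z * indicator L z =
        ?c * (f z * ennreal (cmod (V' z)) * indicator (L \<inter> W) z)"
    proof eventually_elim
      case (elim z)
      then have "indicator L z = (indicator (L \<inter> W) z :: ennreal)" using LW by (auto simp: indicator_def)
      moreover have "ennreal (cmod (V' z) / (2 * pi * real m)) = ?c * ennreal (cmod (V' z))"
        by (simp add: ennreal_mult[symmetric])
      ultimately show ?case by (simp add: mult_ac)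
    qed
  qed
  also have "\<dots> = ?c * (\<integral>\<^sup>+z. f z * ennreal (cmod (V' z)) * indicator (L \<inter> W) z \<partial>hausdorff1)"
    using borel_open[OF W] by (intro nn_integral_cmult) auto
  also have "\<dots> = ?c * (\<integral>\<^sup>+t. (\<Sum>z | cpoly V z = exp (\<i> * of_real t). f z) * indicator {0..2 * pi} t \<partial>lborel)"
    unfolding area using NAE by (intro arg_cong2[where f="(*)"] refl nn_integral_cong_AE)
  finally show ?thesis .
qed

lemma card_cpoly_level_cofinite:
  assumes V: "lead_coeff V = 1" "degree V = m" "m \<ge> 1"
  shows "finite {w. card {z. cpoly V z = w} \<noteq> m}"
proof (rule finite_subset)
  show "{w. card {z. cpoly V z = w} \<noteq> m} \<subseteq> cpoly V ` {z. cpoly (pderiv V) z = 0}"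
  proof
    fix w assume "w \<in> {w. card {z. cpoly V z = w} \<noteq> m}"
    then obtain z where "cpoly V z = w" "cpoly (pderiv V) z = 0"
      using card_cpoly_level[OF V, of w] by blast
    then show "w \<in> cpoly V ` {z. cpoly (pderiv V) z = 0}" by blast
  qed
  have "pderiv V \<noteq> 0" using V by (auto simp: pderiv_eq_0_iff)
  then show "finite (cpoly V ` {z. cpoly (pderiv V) z = 0})"
    by (intro finite_imageI poly_roots_finite cpoly_map_nonzero)
qed

lemma AE_exp_circle_notin:
  assumes "finite X"
  shows "AE t in lborel. t \<in> {0..2 * pi} \<longrightarrow> exp (\<i> * of_real t) \<notin> X"
proof -
  have inj: "inj_on (\<lambda>t::real. exp (\<i> * of_real t)) {0<..<2 * pi}"
  proof (rule inj_onI)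
    fix s t :: real
    assume st: "s \<in> {0<..<2 * pi}" "t \<in> {0<..<2 * pi}" "exp (\<i> * of_real s) = exp (\<i> * of_real t)"
    \<comment> \<open>Shifting by \<open>pi\<close> moves the angle into the open principal strip,
      where \<open>Ln\<close> inverts \<open>exp\<close>.\<close>
    have "Ln (exp (\<i> * of_real (u - pi))) = \<i> * of_real (u - pi)" if "u \<in> {0<..<2 * pi}" for u
      using that by (intro Ln_exp) auto
    moreover have "exp (\<i> * of_real (s - pi)) = exp (\<i> * of_real (t - pi))"
      using st(3) by (simp add: algebra_simps exp_diff)
    ultimately have "\<i> * of_real (s - pi) = \<i> * of_real (t - pi)" using st by metis
    then show "s = t" by (simp del: of_real_diff)
  qed
  have "finite ({0, 2 * pi} \<union> ((\<lambda>t::real. exp (\<i> * of_real t)) -` X \<inter> {0<..<2 * pi}))"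
    using finite_vimage_IntI[OF assms inj] by simp
  then have "AE t in lborel. t \<notin> {0, 2 * pi} \<union> ((\<lambda>t::real. exp (\<i> * of_real t)) -` X \<inter> {0<..<2 * pi})"
    by (intro AE_not_in finite_imp_null_set_lborel)
  then show ?thesis by eventually_elim auto
qed

text \<open>The transfer formula for the constant 1 counts \<open>m\<close> points in almost every
  fibre. Finite mass is what makes constants integrable later.\<close>

lemma emeasure_lemniscate_measure:
  assumes V: "lead_coeff V = 1" "degree V = m" "m \<ge> 1"
  shows "emeasure (lemniscate_measure V) (space (lemniscate_measure V)) = 1"
proof -
  have "emeasure (lemniscate_measure V) (space (lemniscate_measure V)) = (\<integral>\<^sup>+z. 1 \<partial>lemniscate_measure V)"
    by simp
  also have "\<dots> = ennreal (1 / (2 * pi * real m)) *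
      (\<integral>\<^sup>+t. (\<Sum>z | cpoly V z = exp (\<i> * of_real t). 1) * indicator {0..2 * pi} t \<partial>lborel)"
    by (rule nn_integral_lemniscate_measure[OF V]) simp
  also have "(\<integral>\<^sup>+t. (\<Sum>z | cpoly V z = exp (\<i> * of_real t). 1) * indicator {0..2 * pi} t \<partial>lborel)
      = (\<integral>\<^sup>+t. ennreal (real m) * indicator {0..2 * pi} t \<partial>lborel)"
    using AE_exp_circle_notin[OF card_cpoly_level_cofinite[OF V]]
    by (intro nn_integral_cong_AE, eventually_elim)
       (auto simp: indicator_def ennreal_of_nat_eq_real_of_nat)
  also have "\<dots> = ennreal (real m * (2 * pi))"
    by (subst nn_integral_cmult_indicator) (auto simp: ennreal_mult)
  also have "ennreal (1 / (2 * pi * real m)) * \<dots> = 1"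
    using V by (simp add: ennreal_mult[symmetric])
  finally show ?thesis .
qed

lemma borel_measurable_lemniscate_measure:
  "f \<in> borel_measurable borel \<Longrightarrow> f \<in> borel_measurable (lemniscate_measure V)"
  unfolding lemniscate_measure_def by (simp add: measurable_restrict_space1)

lemma space_lemniscate_measure: "space (lemniscate_measure V) = lemniscate V"
  unfolding lemniscate_measure_def by (simp add: space_restrict_space)

text \<open>Common source of both bounds: \<open>k = 1\<close> for the norm polynomial and
  \<open>k = m\<close> for a composition with \<open>V\<close>. On the compact lemniscate
  \<open>ln |P|\<close> has an upper bound \<open>C\<close> but may be unbounded below, so the
  nonnegative transfer formula is applied to \<open>C - p\<close>.\<close>

lemma integral_ln_lemniscate_measure:
  fixes V P Q :: "int poly" and k :: real
  assumes V: "lead_coeff V = 1" "degree V = m" "m \<ge> 1"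
    and Q: "Q \<noteq> 0" and X: "finite X"
    and PQ: "\<And>w. w \<notin> X \<Longrightarrow> cmod w = 1 \<Longrightarrow>
      (\<Sum>z | cpoly V z = w. ln (cmod (cpoly P z))) = k * ln (cmod (cpoly Q w))"
  shows "(\<integral>z. ln (cmod (cpoly P z)) \<partial>lemniscate_measure V) =
    k / real m * (1 / (2 * pi) * (LINT t:{0..2 * pi}|lborel. ln (cmod (cpoly Q (exp (\<i> * of_real t))))))"
proof -
  define \<mu> where "\<mu> = lemniscate_measure V"
  define p where "p z = ln (cmod (cpoly P z))" for z
  define q where "q t = ln (cmod (cpoly Q (exp (\<i> * of_real t))))" for t :: real
  define I where "I = (LINT t:{0..2 * pi}|lborel. q t)"
  have [measurable]: "p \<in> borel_measurable borel" unfolding p_def by measurable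
  have p\<mu>: "p \<in> borel_measurable \<mu>" unfolding \<mu>_def by (intro borel_measurable_lemniscate_measure) measurable
  have q: "set_integrable lborel {0..2 * pi} q"
    unfolding q_def using Q by (intro set_integrable_ln_cmod_poly_circle cpoly_map_nonzero)
  have "bounded (cpoly P ` lemniscate V)"
    using compact_lemniscate V
    by (intro compact_imp_bounded compact_continuous_image continuous_intros) auto
  then obtain B where B: "\<And>z. z \<in> lemniscate V \<Longrightarrow> cmod (cpoly P z) \<le> B"
    unfolding bounded_iff by auto
  \<comment> \<open>The absolute value makes \<open>C\<close> nonnegative, as required at zeros of
    \<open>P\<close>, where \<open>p\<close> is 0 by default.\<close>
  define C where "C = \<bar>B\<bar>"
  have C: "p z \<le> C" if "z \<in> lemniscate V" for z
  proof (cases "cpoly P z = 0")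
    case False
    then have "p z \<le> cmod (cpoly P z) - 1" unfolding p_def by (intro ln_le_minus_one) auto
    then show ?thesis using B[OF that] unfolding C_def by auto
  qed (auto simp: p_def C_def)
  have fib: "\<forall>z. cpoly V z = w \<longrightarrow> p z \<le> C" if "cmod w = 1" for w
    using C that unfolding lemniscate_def by auto
  \<comment> \<open>\<open>ennreal\<close> truncates negative reals to 0, so the second claim is
    required to read off the real value from the first.\<close>
  have nn: "(\<integral>\<^sup>+z. ennreal (C - p z) \<partial>\<mu>) = ennreal (C - k / real m * (1 / (2 * pi) * I))"
    and bound: "0 \<le> C - k / real m * (1 / (2 * pi) * I)"
  proof -
    let ?g = "\<lambda>t. indicator {0..2 * pi} t * (real m * C - k * q t)"
    have sum: "AE t in lborel. t \<in> {0..2 * pi} \<longrightarrow>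
        (\<Sum>z | cpoly V z = exp (\<i> * of_real t). C - p z) = real m * C - k * q t"
      using AE_exp_circle_notin[OF finite_UnI[OF X card_cpoly_level_cofinite[OF V]]]
    proof eventually_elim
      case (elim t)
      show ?case
      proof
        assume "t \<in> {0..2 * pi}"
        with elim have "exp (\<i> * of_real t) \<notin> X" "card {z. cpoly V z = exp (\<i> * of_real t)} = m" by auto
        then show "(\<Sum>z | cpoly V z = exp (\<i> * of_real t). C - p z) = real m * C - k * q t"
          using PQ[of "exp (\<i> * of_real t)"] by (simp add: sum_subtractf p_def q_def)
      qed
    qed
    have g_nn: "AE t in lborel. 0 \<le> ?g t"
      using sum
    proof eventually_elim
      case (elim t)
      have "0 \<le> (\<Sum>z | cpoly V z = exp (\<i> * of_real t). C - p z)"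
        using fib[of "exp (\<i> * of_real t)"] by (intro sum_nonneg) auto
      then show ?case using elim by (auto simp: indicator_def)
    qed
    have g_int: "integrable lborel ?g" "(\<integral>t. ?g t \<partial>lborel) = 2 * pi * real m * C - k * I"
    proof -
      have c: "set_integrable lborel {0..2 * pi} (\<lambda>t. real m * C)"
        by (intro borel_integrable_atLeastAtMost') auto
      have kq: "set_integrable lborel {0..2 * pi} (\<lambda>t. k * q t)"
        using q by simp
      show "integrable lborel ?g"
        using set_integral_diff(1)[OF c kq] by (simp add: set_integrable_def)
      have "(LINT t:{0..2 * pi}|lborel. real m * C - k * q t) = 2 * pi * real m * C - k * I"
        unfolding set_integral_diff(2)[OF c kq] I_def by (simp add: set_lebesgue_integral_def)
      then show "(\<integral>t. ?g t \<partial>lborel) = 2 * pi * real m * C - k * I" by (simp add: set_lebesgue_integral_def)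
    qed
    have "(\<integral>\<^sup>+z. ennreal (C - p z) \<partial>\<mu>) = ennreal (1 / (2 * pi * real m)) *
      (\<integral>\<^sup>+t. (\<Sum>z | cpoly V z = exp (\<i> * of_real t). ennreal (C - p z)) * indicator {0..2 * pi} t \<partial>lborel)"
      unfolding \<mu>_def by (rule nn_integral_lemniscate_measure[OF V]) measurable
    also have "(\<integral>\<^sup>+t. (\<Sum>z | cpoly V z = exp (\<i> * of_real t). ennreal (C - p z)) * indicator {0..2 * pi} t \<partial>lborel)
        = (\<integral>\<^sup>+t. ennreal (?g t) \<partial>lborel)"
      using sum
    proof (intro nn_integral_cong_AE, eventually_elim)
      case (elim t)
      have "(\<Sum>z | cpoly V z = exp (\<i> * of_real t). ennreal (C - p z))
          = ennreal (\<Sum>z | cpoly V z = exp (\<i> * of_real t). C - p z)"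
        using fib[of "exp (\<i> * of_real t)"] by (intro sum_ennreal) auto
      then show ?case using elim by (auto simp: indicator_def)
    qed
    also have "\<dots> = ennreal (2 * pi * real m * C - k * I)"
      unfolding g_int(2)[symmetric] by (rule nn_integral_eq_integral[OF g_int(1) g_nn])
    also have "ennreal (1 / (2 * pi * real m)) * \<dots> = ennreal (1 / (2 * pi * real m) * (2 * pi * real m * C - k * I))"
      by (rule ennreal_mult''[symmetric]) (use integral_nonneg_AE[OF g_nn] g_int(2) in simp)
    also have eq: "1 / (2 * pi * real m) * (2 * pi * real m * C - k * I) = C - k / real m * (1 / (2 * pi) * I)"
      using V by (simp add: field_simps)
    finally show "(\<integral>\<^sup>+z. ennreal (C - p z) \<partial>\<mu>) = ennreal (C - k / real m * (1 / (2 * pi) * I))" .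
    have "0 \<le> 1 / (2 * pi * real m) * (2 * pi * real m * C - k * I)"
      by (rule mult_nonneg_nonneg) (use integral_nonneg_AE[OF g_nn] g_int(2) in simp_all)
    then show "0 \<le> C - k / real m * (1 / (2 * pi) * I)" unfolding eq .
  qed
  have mass: "emeasure \<mu> (space \<mu>) = 1" unfolding \<mu>_def by (rule emeasure_lemniscate_measure[OF V])
  then interpret finite_measure \<mu> by (intro finite_measureI) auto
  have Cp_nn: "AE z in \<mu>. 0 \<le> C - p z"
    using C by (intro AE_I2) (auto simp: \<mu>_def space_lemniscate_measure)
  have Cp_meas: "(\<lambda>z. C - p z) \<in> borel_measurable \<mu>" using p\<mu> by measurable
  have int: "integrable \<mu> (\<lambda>z. C - p z)"
    using nn by (intro integrableI_nn_integral_finite[OF Cp_meas Cp_nn]) auto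
  have "(\<integral>z. C - p z \<partial>\<mu>) = C - k / real m * (1 / (2 * pi) * I)"
    using bound by (subst integral_eq_nn_integral[OF Cp_meas Cp_nn]) (simp add: nn)
  \<comment> \<open>The integral of \<open>p\<close> is recovered as total mass times
    \<open>C\<close>, minus the integral of the gap.\<close>
  moreover have "(\<integral>z. C - (C - p z) \<partial>\<mu>) = (\<integral>z. C \<partial>\<mu>) - (\<integral>z. C - p z \<partial>\<mu>)"
    by (rule Bochner_Integration.integral_diff) (use int in auto)
  moreover have "(\<integral>z. C \<partial>\<mu>) = C" using mass by (simp add: measure_def)
  ultimately have "(\<integral>z. p z \<partial>\<mu>) = k / real m * (1 / (2 * pi) * I)" by simp
  then show ?thesis unfolding \<mu>_def p_def I_def q_def .
qed

section \<open>Comparison of the lemniscate and classical Mahler measures\<close>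

lemma mahler_measure_lemniscate_eq_powr:
  assumes V: "lead_coeff V = 1" "degree V = m" "m \<ge> 1" and P: "P \<noteq> 0"
  obtains Q where "mahler_measure_lemniscate V P = mahler_measure Q powr (1 / real m)"
proof -
  obtain Q :: "int poly" where Q:
    "\<And>w. card {z. cpoly V z = w} = m \<Longrightarrow> cpoly Q w = (\<Prod>z | cpoly V z = w. cpoly P z)"
    using norm_poly_exists[OF V] by metis
  \<comment> \<open>Besides degenerate fibres, the values of \<open>V\<close> at zeros of
    \<open>P\<close> are removed: there the logarithm of the product does not split, because
    \<open>ln 0 = 0\<close>.\<close>
  define X where "X = {w. card {z. cpoly V z = w} \<noteq> m} \<union> cpoly V ` {z. cpoly P z = 0}"
  have X: "finite X"
    unfolding X_def using card_cpoly_level_cofinite[OF V] P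
    by (intro finite_UnI finite_imageI poly_roots_finite cpoly_map_nonzero)
  have fin: "finite {z. cpoly V z = w}" for w using finite_cpoly_level V by simp
  have nz: "cpoly Q w \<noteq> 0" if "w \<notin> X" for w
    using that Q[of w] fin unfolding X_def by auto
  \<comment> \<open>A value outside the finite set \<open>X\<close> witnesses
    \<open>Q \<noteq> 0\<close>, so that \<open>mahler_measure Q\<close> is the exponential and not
    the default 0.\<close>
  obtain w where "w \<notin> X" using ex_new_if_finite[OF infinite_UNIV_char_0 X] by blast
  then have "Q \<noteq> 0" using nz by force
  have "(\<Sum>z | cpoly V z = w. ln (cmod (cpoly P z))) = 1 * ln (cmod (cpoly Q w))" if "w \<notin> X" for w
  proof -
    have "cpoly Q w = (\<Prod>z | cpoly V z = w. cpoly P z)" using that Q unfolding X_def by blast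
    then have "ln (cmod (cpoly Q w)) = ln (\<Prod>z | cpoly V z = w. cmod (cpoly P z))"
      by (simp add: prod_norm)
    also have "\<dots> = (\<Sum>z | cpoly V z = w. ln (cmod (cpoly P z)))"
      using that fin unfolding X_def by (intro ln_prod) auto
    finally show ?thesis by simp
  qed
  from integral_ln_lemniscate_measure[OF V \<open>Q \<noteq> 0\<close> X this]
  have "mahler_measure_lemniscate V P = mahler_measure Q powr (1 / real m)"
    using P \<open>Q \<noteq> 0\<close> unfolding mahler_measure_lemniscate_def mahler_measure_def powr_def by simp
  then show thesis by (rule that)
qed

text \<open>Almost every fibre contributes \<open>m\<close> equal terms, which cancels the
  normalising factor \<open>1 / m\<close>.\<close>

lemma mahler_measure_lemniscate_pcompose:
  assumes V: "lead_coeff V = 1" "degree V = m" "m \<ge> 1"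
  shows "mahler_measure_lemniscate V (Q \<circ>\<^sub>p V) = mahler_measure Q"
proof (cases "Q = 0")
  case False
  then have nz: "Q \<circ>\<^sub>p V \<noteq> 0" using V pcompose_eq_0[of Q V] by auto
  have comp: "cpoly (Q \<circ>\<^sub>p V) z = cpoly Q (cpoly V z)" for z
    by (induction Q) (simp_all add: pcompose_pCons map_poly_pCons)
  have "(\<Sum>z | cpoly V z = w. ln (cmod (cpoly (Q \<circ>\<^sub>p V) z))) = real m * ln (cmod (cpoly Q w))"
    if "w \<notin> {w. card {z. cpoly V z = w} \<noteq> m}" for w
    using that by (simp add: comp)
  from integral_ln_lemniscate_measure[OF V False card_cpoly_level_cofinite[OF V] this]
  show ?thesis
    using nz False V unfolding mahler_measure_lemniscate_def mahler_measure_def by simp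
qed (simp add: mahler_measure_lemniscate_def mahler_measure_def)

theorem theorem2p3:
  fixes V :: "int poly" and m :: nat
  assumes "lead_coeff V = 1" and "degree V = m" and "m \<ge> 1"
  shows "B_circle powr (1 / real m) \<le> B_lemniscate V \<and> B_lemniscate V \<le> B_circle"
proof
  let ?T = "{mahler_measure P | P. mahler_measure P > 1}"
  let ?L = "{mahler_measure_lemniscate V P | P. mahler_measure_lemniscate V P > 1}"
  \<comment> \<open>Composition with \<open>V\<close> realises each classical value as a lemniscate
    value.\<close>
  have sub: "?T \<subseteq> ?L"
    using mahler_measure_lemniscate_pcompose[OF assms] by (smt (verit) Collect_mono)
  \<comment> \<open>The infimum of an empty set of reals is unspecified, so a value above 1 has to
    be exhibited.\<close>
  have "mahler_measure [:2:] = 2"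
    by (simp add: mahler_measure_def set_lebesgue_integral_def map_poly_pCons)
  then have "2 \<in> ?T" by (auto intro!: exI[of _ "[:2:]"])
  then have ne: "?T \<noteq> {}" "?L \<noteq> {}" using sub by blast+
  have bdd: "bdd_below ?T" "bdd_below ?L" by (auto intro!: bdd_belowI[of _ 1])
  show "B_lemniscate V \<le> B_circle"
    unfolding B_lemniscate_def B_circle_def using sub ne bdd by (intro cInf_superset_mono)
  have B: "0 \<le> B_circle"
    unfolding B_circle_def using ne by (intro cInf_greatest) auto
  show "B_circle powr (1 / real m) \<le> B_lemniscate V"
    unfolding B_lemniscate_def
  proof (rule cInf_greatest[OF ne(2)], safe)
    fix P assume gt: "1 < mahler_measure_lemniscate V P"
    then have "P \<noteq> 0" by (auto simp: mahler_measure_lemniscate_def)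
    then obtain Q where Q: "mahler_measure_lemniscate V P = mahler_measure Q powr (1 / real m)"
      using mahler_measure_lemniscate_eq_powr[OF assms] by metis
    have "0 \<le> mahler_measure Q" by (simp add: mahler_measure_def)
    \<comment> \<open>If \<open>mahler_measure Q\<close> were at most 1, so would be its positive
      power.\<close>
    then have "1 < mahler_measure Q"
      using gt powr_mono2[of "1 / real m" "mahler_measure Q" 1] unfolding Q by force
    then have "B_circle \<le> mahler_measure Q"
      unfolding B_circle_def by (intro cInf_lower bdd) auto
    then show "B_circle powr (1 / real m) \<le> mahler_measure_lemniscate V P"
      unfolding Q using B by (intro powr_mono2) auto
  qed
qed

end
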